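(* Let $\mathcal B$ be either the category $\mathcal R(\sigma)$ of $\sigma$-structures and homomorphisms, for a fixed relational signature $\sigma$, or the category $\mathbf{Graph}$ of graphs and graph homomorphisms. Let $\Delta$ be a component-based class of finite objects of $\mathcal B$. Then $\Delta$ can be classified by a comonad, i.e. there exists a comonad $\mathbb C$ on $\mathcal B$ such that, for every finite object $X$ of $\mathcal B$, $X\in\Delta$ if and only if $X$ admits a $\mathbb C$-coalgebra.
   Context: A relational signature $\sigma$ is a set of relation symbols of positive finite arity. Objects of $\mathcal R(\sigma)$ are arbitrary (possibly infinite, possibly empty) $\sigma$-structures; a homomorphism $f\colon A\to B$ is a function such that $R^A(x_1,\dots,x_n)$ implies $R^B(f(x_1),\dots,f(x_n))$ for each $R\in\sigma$. Objects of $\mathbf{Graph}$ are undirected loopless graphs (possibly infinite or empty); morphisms are edge-preserving functions. In both categories coproducts are disjoint unions. A class $\Delta$ of finite objects is component-based if it is closed under isomorphisms, under finite coproducts (including the empty one), and under summands (if $A+B\in\Delta$ then $A\in\Delta$ and $B\in\Delta$). For a comonad $(\mathbb C,\varepsilon,\delta)$ on $\mathcal B$, a ($\mathbb C$-)coalgebra (always in the Eilenberg--Moore sense) on $X$ is a morphism $\alpha\colon X\to\mathbb C(X)$ with $\varepsilon_X\circ\alpha=\mathrm{id}_X$ and $\delta_X\circ\alpha=\mathbb C(\alpha)\circ\alpha$. $X$ admits a $\mathbb C$-coalgebra if such an $\alpha$ exists. *)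

theory Defs
  imports "HOL-Library.FuncSet" "HOL-Library.Equipollence"
begin

section \<open>Categories, comonads and Eilenberg--Moore coalgebras\<close>

record ('o, 'm) cat =
  Obj :: "'o set"
  Hom :: "'o \<Rightarrow> 'o \<Rightarrow> 'm set"
  Id :: "'o \<Rightarrow> 'm"
  Comp :: "'m \<Rightarrow> 'm \<Rightarrow> 'm"  (infixr \<open>\<cdot>\<index>\<close> 70)

definition category :: "('o, 'm) cat \<Rightarrow> bool" where
  "category B \<longleftrightarrow>
     (\<forall>X\<in>Obj B. Id B X \<in> Hom B X X) \<and>
     (\<forall>X\<in>Obj B. \<forall>Y\<in>Obj B. \<forall>Z\<in>Obj B. \<forall>f\<in>Hom B X Y. \<forall>g\<in>Hom B Y Z. g \<cdot>\<^bsub>B\<^esub> f \<in> Hom B X Z) \<and>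
     (\<forall>X\<in>Obj B. \<forall>Y\<in>Obj B. \<forall>f\<in>Hom B X Y. f \<cdot>\<^bsub>B\<^esub> Id B X = f \<and> Id B Y \<cdot>\<^bsub>B\<^esub> f = f) \<and>
     (\<forall>W\<in>Obj B. \<forall>X\<in>Obj B. \<forall>Y\<in>Obj B. \<forall>Z\<in>Obj B. \<forall>f\<in>Hom B W X. \<forall>g\<in>Hom B X Y. \<forall>h\<in>Hom B Y Z.
        h \<cdot>\<^bsub>B\<^esub> (g \<cdot>\<^bsub>B\<^esub> f) = (h \<cdot>\<^bsub>B\<^esub> g) \<cdot>\<^bsub>B\<^esub> f) \<and>
     (\<forall>X\<in>Obj B. \<forall>Y\<in>Obj B. \<forall>X'\<in>Obj B. \<forall>Y'\<in>Obj B. Hom B X Y \<inter> Hom B X' Y' \<noteq> {} \<longrightarrow> X = X' \<and> Y = Y')"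

definition isomorphic :: "('o, 'm) cat \<Rightarrow> 'o \<Rightarrow> 'o \<Rightarrow> bool" where
  "isomorphic B X Y \<longleftrightarrow>
     (\<exists>f\<in>Hom B X Y. \<exists>g\<in>Hom B Y X. g \<cdot>\<^bsub>B\<^esub> f = Id B X \<and> f \<cdot>\<^bsub>B\<^esub> g = Id B Y)"

text \<open>For \<open>I = {}\<close> this says that \<open>S\<close> is an initial object.\<close>

definition is_coproduct ::
  "('o, 'm) cat \<Rightarrow> 'i set \<Rightarrow> ('i \<Rightarrow> 'o) \<Rightarrow> 'o \<Rightarrow> ('i \<Rightarrow> 'm) \<Rightarrow> bool" where
  "is_coproduct B I A S \<iota> \<longleftrightarrow>
     S \<in> Obj B \<and> (\<forall>i\<in>I. A i \<in> Obj B \<and> \<iota> i \<in> Hom B (A i) S) \<and>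
     (\<forall>Y\<in>Obj B. \<forall>f. (\<forall>i\<in>I. f i \<in> Hom B (A i) Y) \<longrightarrow>
        (\<exists>!h. h \<in> Hom B S Y \<and> (\<forall>i\<in>I. h \<cdot>\<^bsub>B\<^esub> \<iota> i = f i)))"

text \<open>\<open>F\<close> is the class of finite objects of \<open>B\<close>. As coproducts are only determined up to
  isomorphism, the closure conditions refer to every object carrying a coproduct structure.\<close>

definition component_based :: "('o, 'm) cat \<Rightarrow> 'o set \<Rightarrow> 'o set \<Rightarrow> bool" where
  "component_based B F \<Delta> \<longleftrightarrow>
     \<Delta> \<subseteq> F \<and>
     (\<forall>X\<in>\<Delta>. \<forall>Y\<in>Obj B. isomorphic B X Y \<longrightarrow> Y \<in> \<Delta>) \<and>
     (\<forall>(n::nat) A S \<iota>. (\<forall>i<n. A i \<in> \<Delta>) \<and> is_coproduct B {..<n} A S \<iota> \<longrightarrow> S \<in> \<Delta>) \<and>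
     (\<forall>A A' S \<iota>. is_coproduct B (UNIV::bool set) (\<lambda>b. if b then A else A') S \<iota> \<and> S \<in> \<Delta>
        \<longrightarrow> A \<in> \<Delta> \<and> A' \<in> \<Delta>)"

record ('o, 'm) comonad_data =
  on_obj :: "'o \<Rightarrow> 'o"
  on_mor :: "'m \<Rightarrow> 'm"
  counit :: "'o \<Rightarrow> 'm"
  comult :: "'o \<Rightarrow> 'm"

definition endofunctor :: "('o, 'm) cat \<Rightarrow> ('o \<Rightarrow> 'o) \<Rightarrow> ('m \<Rightarrow> 'm) \<Rightarrow> bool" where
  "endofunctor B T M \<longleftrightarrow>
     (\<forall>X\<in>Obj B. T X \<in> Obj B) \<and>
     (\<forall>X\<in>Obj B. \<forall>Y\<in>Obj B. \<forall>f\<in>Hom B X Y. M f \<in> Hom B (T X) (T Y)) \<and>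
     (\<forall>X\<in>Obj B. M (Id B X) = Id B (T X)) \<and>
     (\<forall>X\<in>Obj B. \<forall>Y\<in>Obj B. \<forall>Z\<in>Obj B. \<forall>f\<in>Hom B X Y. \<forall>g\<in>Hom B Y Z.
        M (g \<cdot>\<^bsub>B\<^esub> f) = M g \<cdot>\<^bsub>B\<^esub> M f)"

definition comonad :: "('o, 'm) cat \<Rightarrow> ('o, 'm) comonad_data \<Rightarrow> bool" where
  "comonad B C \<longleftrightarrow>
     (let T = on_obj C; M = on_mor C; \<epsilon> = counit C; \<delta> = comult C in
       endofunctor B T M \<and>
       (\<forall>X\<in>Obj B. \<epsilon> X \<in> Hom B (T X) X \<and> \<delta> X \<in> Hom B (T X) (T (T X))) \<and>
       (\<forall>X\<in>Obj B. \<forall>Y\<in>Obj B. \<forall>f\<in>Hom B X Y.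
          \<epsilon> Y \<cdot>\<^bsub>B\<^esub> M f = f \<cdot>\<^bsub>B\<^esub> \<epsilon> X \<and> \<delta> Y \<cdot>\<^bsub>B\<^esub> M f = M (M f) \<cdot>\<^bsub>B\<^esub> \<delta> X) \<and>
       (\<forall>X\<in>Obj B.
          \<epsilon> (T X) \<cdot>\<^bsub>B\<^esub> \<delta> X = Id B (T X) \<and>
          M (\<epsilon> X) \<cdot>\<^bsub>B\<^esub> \<delta> X = Id B (T X) \<and>
          \<delta> (T X) \<cdot>\<^bsub>B\<^esub> \<delta> X = M (\<delta> X) \<cdot>\<^bsub>B\<^esub> \<delta> X))"

definition coalgebra :: "('o, 'm) cat \<Rightarrow> ('o, 'm) comonad_data \<Rightarrow> 'o \<Rightarrow> 'm \<Rightarrow> bool" where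
  "coalgebra B C X \<alpha> \<longleftrightarrow>
     \<alpha> \<in> Hom B X (on_obj C X) \<and>
     counit C X \<cdot>\<^bsub>B\<^esub> \<alpha> = Id B X \<and>
     comult C X \<cdot>\<^bsub>B\<^esub> \<alpha> = on_mor C \<alpha> \<cdot>\<^bsub>B\<^esub> \<alpha>"

definition classifies :: "('o, 'm) cat \<Rightarrow> 'o set \<Rightarrow> ('o, 'm) comonad_data \<Rightarrow> 'o set \<Rightarrow> bool" where
  "classifies B F C \<Delta> \<longleftrightarrow> comonad B C \<and> (\<forall>X\<in>F. X \<in> \<Delta> \<longleftrightarrow> (\<exists>\<alpha>. coalgebra B C X \<alpha>))"


section \<open>The size of objects\<close>

text \<open>The category of all structures is a proper class, so it is taken relative to a notion of
  small set: objects are those whose underlying set belongs to a family \<open>U\<close> of subsets of a type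
  that is determined by cardinality, closed downwards, and goes beyond the finite sets. Examples
  are all subsets of an infinite type and, when the type has strongly inaccessible cardinality,
  its subsets of smaller cardinality (a Grothendieck universe, up to bijection).\<close>

definition smallness :: "'u set set \<Rightarrow> bool" where
  "smallness U \<longleftrightarrow> (\<forall>A\<in>U. \<forall>B. B \<lesssim> A \<longrightarrow> B \<in> U) \<and> (\<exists>A\<in>U. infinite A)"


section \<open>Relational structures and graphs\<close>

text \<open>A morphism \<open>(A, f, B)\<close> carries its domain and codomain; \<open>f\<close> is extensional, i.e.\
  \<open>undefined\<close> outside the underlying set of \<open>A\<close>, so that equality of morphisms is equality of
  functions on that set.\<close>

definition arrow_id :: "('o \<Rightarrow> 'u set) \<Rightarrow> 'o \<Rightarrow> 'o \<times> ('u \<Rightarrow> 'u) \<times> 'o" where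
  "arrow_id pts A = (A, (\<lambda>x\<in>pts A. x), A)"

definition arrow_comp :: "('o \<Rightarrow> 'u set) \<Rightarrow> 'o \<times> ('u \<Rightarrow> 'u) \<times> 'o
    \<Rightarrow> 'o \<times> ('u \<Rightarrow> 'u) \<times> 'o \<Rightarrow> 'o \<times> ('u \<Rightarrow> 'u) \<times> 'o" where
  "arrow_comp pts = (\<lambda>(_, g, C) (A, f, _). (A, compose (pts A) g f, C))"

text \<open>A signature must be small relative to \<open>U\<close>. In set theory, a small set has a small power
  set; since \<open>U\<close> need not be closed under power sets, this consequence is required directly.
  It holds for every finite \<open>\<sigma>\<close>.\<close>

definition signature :: "'u set set \<Rightarrow> 'r set \<Rightarrow> ('r \<Rightarrow> nat) \<Rightarrow> bool" where
  "signature U \<sigma> ar \<longleftrightarrow> (\<forall>R\<in>\<sigma>. 0 < ar R) \<and> (\<exists>A\<in>U. Pow \<sigma> \<lesssim> A)"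

record ('r, 'u) struct =
  points :: "'u set"
  interp :: "'r \<Rightarrow> 'u list set"

text \<open>Symbols outside the signature \<open>\<sigma>\<close> get the empty interpretation, so that they play no role.\<close>

definition is_struct :: "'r set \<Rightarrow> ('r \<Rightarrow> nat) \<Rightarrow> ('r, 'u) struct \<Rightarrow> bool" where
  "is_struct \<sigma> ar A \<longleftrightarrow>
     (\<forall>R\<in>\<sigma>. interp A R \<subseteq> {xs. length xs = ar R \<and> set xs \<subseteq> points A}) \<and>
     (\<forall>R. R \<notin> \<sigma> \<longrightarrow> interp A R = {})"

definition struct_hom :: "'r set \<Rightarrow> ('r, 'u) struct \<Rightarrow> ('r, 'u) struct \<Rightarrow> ('u \<Rightarrow> 'u) set" where
  "struct_hom \<sigma> A B =
     {f \<in> points A \<rightarrow>\<^sub>E points B. \<forall>R\<in>\<sigma>. \<forall>xs\<in>interp A R. map f xs \<in> interp B R}"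

definition Struct_cat :: "'u set set \<Rightarrow> 'r set \<Rightarrow> ('r \<Rightarrow> nat)
    \<Rightarrow> (('r, 'u) struct, ('r, 'u) struct \<times> ('u \<Rightarrow> 'u) \<times> ('r, 'u) struct) cat" where
  "Struct_cat U \<sigma> ar =
     \<lparr>Obj = {A. points A \<in> U \<and> is_struct \<sigma> ar A},
      Hom = (\<lambda>A B. {(A, f, B) | f. f \<in> struct_hom \<sigma> A B}),
      Id = arrow_id points,
      Comp = arrow_comp points\<rparr>"

definition finite_structs :: "'u set set \<Rightarrow> 'r set \<Rightarrow> ('r \<Rightarrow> nat) \<Rightarrow> ('r, 'u) struct set" where
  "finite_structs U \<sigma> ar = {A \<in> Obj (Struct_cat U \<sigma> ar). finite (points A)}"

record 'u ugraph =
  verts :: "'u set"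
  adj :: "('u \<times> 'u) set"

definition is_ugraph :: "'u ugraph \<Rightarrow> bool" where
  "is_ugraph G \<longleftrightarrow> adj G \<subseteq> verts G \<times> verts G \<and> sym (adj G) \<and> irrefl (adj G)"

definition ugraph_hom :: "'u ugraph \<Rightarrow> 'u ugraph \<Rightarrow> ('u \<Rightarrow> 'u) set" where
  "ugraph_hom G H =
     {f \<in> verts G \<rightarrow>\<^sub>E verts H. \<forall>x y. (x, y) \<in> adj G \<longrightarrow> (f x, f y) \<in> adj H}"

definition Graph_cat :: "'u set set \<Rightarrow> ('u ugraph, 'u ugraph \<times> ('u \<Rightarrow> 'u) \<times> 'u ugraph) cat" where
  "Graph_cat U =
     \<lparr>Obj = {G. verts G \<in> U \<and> is_ugraph G},
      Hom = (\<lambda>G H. {(G, f, H) | f. f \<in> ugraph_hom G H}),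
      Id = arrow_id verts,
      Comp = arrow_comp verts\<rparr>"

definition finite_ugraphs :: "'u set set \<Rightarrow> 'u ugraph set" where
  "finite_ugraphs U = {G \<in> Obj (Graph_cat U). finite (verts G)}"

lemma struct_hom_id:
  assumes "is_struct \<sigma> ar A"
  shows "(\<lambda>x\<in>points A. x) \<in> struct_hom \<sigma> A A"
proof -
  have "map (\<lambda>x\<in>points A. x) xs = xs" if "R \<in> \<sigma>" "xs \<in> interp A R" for R xs
    using assms that unfolding is_struct_def by (intro map_idI) auto
  then show ?thesis unfolding struct_hom_def by auto
qed

lemma struct_hom_compose:
  assumes "is_struct \<sigma> ar A" "f \<in> struct_hom \<sigma> A B" "g \<in> struct_hom \<sigma> B C"
  shows "compose (points A) g f \<in> struct_hom \<sigma> A C"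
proof -
  have "map (compose (points A) g f) xs = map g (map f xs)" if "R \<in> \<sigma>" "xs \<in> interp A R" for R xs
    using assms(1) that unfolding is_struct_def by (auto simp: compose_def)
  with assms(2,3) show ?thesis
    unfolding struct_hom_def by (auto simp: compose_def PiE_iff simp del: map_map)
qed

lemma category_Struct_cat: "category (Struct_cat U \<sigma> ar)"
  unfolding category_def
proof (intro conjI)
  show "\<forall>X\<in>Obj (Struct_cat U \<sigma> ar). \<forall>Y\<in>Obj (Struct_cat U \<sigma> ar). \<forall>f\<in>Hom (Struct_cat U \<sigma> ar) X Y.
      f \<cdot>\<^bsub>Struct_cat U \<sigma> ar\<^esub> Id (Struct_cat U \<sigma> ar) X = f \<and>
      Id (Struct_cat U \<sigma> ar) Y \<cdot>\<^bsub>Struct_cat U \<sigma> ar\<^esub> f = f"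
    by (auto simp: Struct_cat_def arrow_id_def arrow_comp_def struct_hom_def PiE_iff
        compose_def fun_eq_iff restrict_def extensional_def)
qed (auto simp: Struct_cat_def arrow_id_def arrow_comp_def struct_hom_id struct_hom_compose,
     auto simp: struct_hom_def PiE_iff compose_def fun_eq_iff restrict_def)

lemma ugraph_hom_id: "is_ugraph G \<Longrightarrow> (\<lambda>x\<in>verts G. x) \<in> ugraph_hom G G"
  by (auto simp: is_ugraph_def ugraph_hom_def)

lemma ugraph_hom_compose:
  "is_ugraph G \<Longrightarrow> f \<in> ugraph_hom G H \<Longrightarrow> g \<in> ugraph_hom H K \<Longrightarrow>
     compose (verts G) g f \<in> ugraph_hom G K"
  by (auto simp: is_ugraph_def ugraph_hom_def compose_def PiE_iff)

lemma category_Graph_cat: "category (Graph_cat U)"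
  unfolding category_def
proof (intro conjI)
  show "\<forall>X\<in>Obj (Graph_cat U). \<forall>Y\<in>Obj (Graph_cat U). \<forall>f\<in>Hom (Graph_cat U) X Y.
      f \<cdot>\<^bsub>Graph_cat U\<^esub> Id (Graph_cat U) X = f \<and>
      Id (Graph_cat U) Y \<cdot>\<^bsub>Graph_cat U\<^esub> f = f"
    by (auto simp: Graph_cat_def arrow_id_def arrow_comp_def ugraph_hom_def PiE_iff
        compose_def fun_eq_iff restrict_def extensional_def)
qed (auto simp: Graph_cat_def arrow_id_def arrow_comp_def ugraph_hom_id ugraph_hom_compose,
     auto simp: ugraph_hom_def PiE_iff compose_def fun_eq_iff restrict_def)

end

theory Submission
  imports Defs
begin

text \<open>Let \<open>K\<close> contain a representative of every isomorphism class in \<open>\<Delta>\<close>, and let \<open>T X\<close> be the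
  coproduct of copies of \<open>D\<close>, one for each \<open>D \<in> K\<close> and each morphism \<open>g : D \<rightarrow> X\<close>. The counit is \<open>g\<close> on
  the summand \<open>(D, g)\<close>, and the comultiplication maps this summand identically onto the summand of
  \<open>T (T X)\<close> indexed by \<open>D\<close> and the injection \<open>D \<rightarrow> T X\<close> at \<open>(D, g)\<close>. An isomorphism \<open>D \<rightarrow> X\<close> gives
  a coalgebra on \<open>X\<close>. Conversely, a coalgebra on \<open>X\<close> exhibits \<open>X\<close> as the disjoint union of those
  \<open>(D, g)\<close> whose summand its image meets; if \<open>X\<close> is finite, then there are finitely many, and closure
  of \<open>\<Delta>\<close> under finite coproducts yields \<open>X \<in> \<Delta>\<close>.\<close>

section \<open>The comonad of a family of objects\<close>

lemma category_id_Hom: "category B \<Longrightarrow> X \<in> Obj B \<Longrightarrow> Id B X \<in> Hom B X X"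
  by (simp add: category_def)

lemma category_comp_Hom:
  assumes "category B" "X \<in> Obj B" "Y \<in> Obj B" "Z \<in> Obj B" "f \<in> Hom B X Y" "g \<in> Hom B Y Z"
  shows "g \<cdot>\<^bsub>B\<^esub> f \<in> Hom B X Z"
  using assms unfolding category_def by blast

lemma category_comp_id:
  assumes "category B" "X \<in> Obj B" "Y \<in> Obj B" "f \<in> Hom B X Y"
  shows "f \<cdot>\<^bsub>B\<^esub> Id B X = f" "Id B Y \<cdot>\<^bsub>B\<^esub> f = f"
  using assms unfolding category_def by blast+

lemma category_comp_assoc:
  assumes "category B" "W \<in> Obj B" "X \<in> Obj B" "Y \<in> Obj B" "Z \<in> Obj B"
    "f \<in> Hom B W X" "g \<in> Hom B X Y" "h \<in> Hom B Y Z"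
  shows "(h \<cdot>\<^bsub>B\<^esub> g) \<cdot>\<^bsub>B\<^esub> f = h \<cdot>\<^bsub>B\<^esub> (g \<cdot>\<^bsub>B\<^esub> f)"
  using assms unfolding category_def by simp

lemma category_Hom_disjoint:
  assumes "category B" "X \<in> Obj B" "Y \<in> Obj B" "X' \<in> Obj B" "Y' \<in> Obj B"
    "f \<in> Hom B X Y" "f \<in> Hom B X' Y'"
  shows "X' = X" "Y' = Y"
  using assms unfolding category_def by blast+

lemma coproduct_copair:
  assumes "is_coproduct B I A S \<iota>" "Y \<in> Obj B" "\<And>i. i \<in> I \<Longrightarrow> f i \<in> Hom B (A i) Y"
  shows "\<exists>h\<in>Hom B S Y. \<forall>i\<in>I. h \<cdot>\<^bsub>B\<^esub> \<iota> i = f i"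
proof -
  have "\<exists>!h. h \<in> Hom B S Y \<and> (\<forall>i\<in>I. h \<cdot>\<^bsub>B\<^esub> \<iota> i = f i)"
    using assms unfolding is_coproduct_def by simp
  then show ?thesis by blast
qed

text \<open>Both morphisms mediate the cocone obtained by restricting \<open>h'\<close> to the
  summands, and mediating morphisms are unique.\<close>

lemma coproduct_ext:
  assumes "category B" "is_coproduct B I A S \<iota>" "Y \<in> Obj B" "h \<in> Hom B S Y" "h' \<in> Hom B S Y"
    "\<And>i. i \<in> I \<Longrightarrow> h \<cdot>\<^bsub>B\<^esub> \<iota> i = h' \<cdot>\<^bsub>B\<^esub> \<iota> i"
  shows "h = h'"
proof -
  have "\<forall>i\<in>I. h' \<cdot>\<^bsub>B\<^esub> \<iota> i \<in> Hom B (A i) Y"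
    using assms category_comp_Hom[OF assms(1)] unfolding is_coproduct_def by blast
  then have "\<exists>!k. k \<in> Hom B S Y \<and> (\<forall>i\<in>I. k \<cdot>\<^bsub>B\<^esub> \<iota> i = h' \<cdot>\<^bsub>B\<^esub> \<iota> i)"
    using assms(2,3) unfolding is_coproduct_def
    by (elim conjE) (drule bspec, assumption, drule spec, erule mp)
  moreover have "h \<in> Hom B S Y \<and> (\<forall>i\<in>I. h \<cdot>\<^bsub>B\<^esub> \<iota> i = h' \<cdot>\<^bsub>B\<^esub> \<iota> i)"
    "h' \<in> Hom B S Y \<and> (\<forall>i\<in>I. h' \<cdot>\<^bsub>B\<^esub> \<iota> i = h' \<cdot>\<^bsub>B\<^esub> \<iota> i)"
    using assms(4-6) by blast+
  ultimately show ?thesis by blast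
qed

text \<open>Closure of \<open>\<Delta>\<close> under finite coproducts refers to index sets
  \<open>{..<n}\<close>, whereas a coalgebra yields a coproduct indexed by summands of
  \<open>T X\<close>. Numbering these summands passes from one form to the other.\<close>

lemma coproduct_reindex:
  assumes b: "bij_betw b I J" and cop: "is_coproduct B J A S \<iota>"
  shows "is_coproduct B I (A \<circ> b) S (\<iota> \<circ> b)"
  unfolding is_coproduct_def
proof (intro conjI ballI allI impI)
  fix Y f assume Y: "Y \<in> Obj B" and f: "\<forall>i\<in>I. f i \<in> Hom B ((A \<circ> b) i) Y"
  let ?c = "inv_into I b"
  have bI: "b i \<in> J" "?c (b i) = i" if "i \<in> I" for i
    using b that by (auto simp: bij_betw_def)
  have cJ: "?c j \<in> I" "b (?c j) = j" if "j \<in> J" for j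
    using b that by (auto simp: bij_betw_def inv_into_into f_inv_into_f)
  have "\<forall>j\<in>J. f (?c j) \<in> Hom B (A j) Y" using f cJ by force
  then have "\<exists>!h. h \<in> Hom B S Y \<and> (\<forall>j\<in>J. h \<cdot>\<^bsub>B\<^esub> \<iota> j = f (?c j))"
    using cop Y unfolding is_coproduct_def by (elim conjE) (drule bspec, assumption, drule spec, erule mp)
  moreover have "(\<forall>j\<in>J. h \<cdot>\<^bsub>B\<^esub> \<iota> j = f (?c j)) \<longleftrightarrow> (\<forall>i\<in>I. h \<cdot>\<^bsub>B\<^esub> (\<iota> \<circ> b) i = f i)" for h
    using b bI(2) by (auto simp: bij_betw_def)
  ultimately show "\<exists>!h. h \<in> Hom B S Y \<and> (\<forall>i\<in>I. h \<cdot>\<^bsub>B\<^esub> (\<iota> \<circ> b) i = f i)" by simp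
qed (use assms in \<open>auto simp: is_coproduct_def bij_betw_def\<close>)

section \<open>Coproducts over all morphisms out of a family, and their comonad\<close>

locale family_coproducts =
  fixes B :: "('o, 'm) cat" (structure) and K :: "'o set"
    and T :: "'o \<Rightarrow> 'o" and inj :: "'o \<Rightarrow> 'o \<times> 'm \<Rightarrow> 'm"
  assumes category: "category B"
    and family: "K \<subseteq> Obj B"
    and coproduct: "X \<in> Obj B \<Longrightarrow> is_coproduct B (SIGMA D:K. Hom B D X) fst (T X) (inj X)"
begin

lemmas comp_Hom = category_comp_Hom[OF category]
lemmas comp_assoc = category_comp_assoc[OF category]
lemmas comp_id = category_comp_id[OF category]

lemma T_Obj [simp]: "X \<in> Obj B \<Longrightarrow> T X \<in> Obj B"
  using coproduct unfolding is_coproduct_def by blast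

lemma K_Obj [simp]: "D \<in> K \<Longrightarrow> D \<in> Obj B"
  using family by blast

lemma inj_Hom [simp]: "X \<in> Obj B \<Longrightarrow> D \<in> K \<Longrightarrow> g \<in> Hom B D X \<Longrightarrow> inj X (D, g) \<in> Hom B D (T X)"
  using coproduct[of X] unfolding is_coproduct_def by fastforce

text \<open>The functor and comonad laws below equate morphisms out of some \<open>T X\<close>, so
  this reduces each of them to a computation on a single summand.\<close>

lemma T_ext:
  assumes "X \<in> Obj B" "Y \<in> Obj B" "h \<in> Hom B (T X) Y" "h' \<in> Hom B (T X) Y"
    "\<And>D g. D \<in> K \<Longrightarrow> g \<in> Hom B D X \<Longrightarrow> h \<cdot> inj X (D, g) = h' \<cdot> inj X (D, g)"
  shows "h = h'"
  using coproduct_ext[OF category coproduct[OF assms(1)] assms(2-4)] assms(5) by auto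

lemma T_copair:
  assumes "X \<in> Obj B" "Y \<in> Obj B" "\<And>D g. D \<in> K \<Longrightarrow> g \<in> Hom B D X \<Longrightarrow> f D g \<in> Hom B D Y"
  shows "\<exists>h\<in>Hom B (T X) Y. \<forall>D\<in>K. \<forall>g\<in>Hom B D X. h \<cdot> inj X (D, g) = f D g"
  using coproduct_copair[OF coproduct[OF assms(1)] assms(2), of "\<lambda>(D, g). f D g"] assms(3) by auto

text \<open>\<open>on_mor\<close> receives a bare morphism, so its domain and codomain have to be
  recovered inside the choice.\<close>

definition T_map :: "'m \<Rightarrow> 'm" where
  "T_map f = (SOME m. \<exists>X\<in>Obj B. \<exists>Y\<in>Obj B. f \<in> Hom B X Y \<and> m \<in> Hom B (T X) (T Y) \<and>
     (\<forall>D\<in>K. \<forall>g\<in>Hom B D X. m \<cdot> inj X (D, g) = inj Y (D, f \<cdot> g)))"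

definition T_counit :: "'o \<Rightarrow> 'm" where
  "T_counit X = (SOME m. m \<in> Hom B (T X) X \<and>
     (\<forall>D\<in>K. \<forall>g\<in>Hom B D X. m \<cdot> inj X (D, g) = g))"

definition T_comult :: "'o \<Rightarrow> 'm" where
  "T_comult X = (SOME m. m \<in> Hom B (T X) (T (T X)) \<and>
     (\<forall>D\<in>K. \<forall>g\<in>Hom B D X. m \<cdot> inj X (D, g) = inj (T X) (D, inj X (D, g))))"

definition T_comonad :: "('o, 'm) comonad_data" where
  "T_comonad = \<lparr>on_obj = T, on_mor = T_map, counit = T_counit, comult = T_comult\<rparr>"

lemma T_map:
  assumes "X \<in> Obj B" "Y \<in> Obj B" "f \<in> Hom B X Y"
  shows T_map_Hom: "T_map f \<in> Hom B (T X) (T Y)"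
    and T_map_inj: "\<And>D g. D \<in> K \<Longrightarrow> g \<in> Hom B D X \<Longrightarrow> T_map f \<cdot> inj X (D, g) = inj Y (D, f \<cdot> g)"
proof -
  have "\<exists>m\<in>Hom B (T X) (T Y). \<forall>D\<in>K. \<forall>g\<in>Hom B D X. m \<cdot> inj X (D, g) = inj Y (D, f \<cdot> g)"
    using assms by (intro T_copair) (auto intro!: inj_Hom comp_Hom[of _ X])
  then have "\<exists>m. \<exists>X\<in>Obj B. \<exists>Y\<in>Obj B. f \<in> Hom B X Y \<and> m \<in> Hom B (T X) (T Y) \<and>
     (\<forall>D\<in>K. \<forall>g\<in>Hom B D X. m \<cdot> inj X (D, g) = inj Y (D, f \<cdot> g))"
    using assms by blast
  from someI_ex[OF this, folded T_map_def] obtain X' Y' where *: "X' \<in> Obj B" "Y' \<in> Obj B"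
    "f \<in> Hom B X' Y'" "T_map f \<in> Hom B (T X') (T Y')"
    "\<forall>D\<in>K. \<forall>g\<in>Hom B D X'. T_map f \<cdot> inj X' (D, g) = inj Y' (D, f \<cdot> g)"
    by blast
  \<comment> \<open>Hom-sets of different pairs of objects are disjoint, so the objects found by the
    choice are the given ones.\<close>
  have "X' = X" "Y' = Y"
    using category_Hom_disjoint[OF category assms(1,2) *(1,2) assms(3) *(3)] .
  with * show "T_map f \<in> Hom B (T X) (T Y)"
    "\<And>D g. D \<in> K \<Longrightarrow> g \<in> Hom B D X \<Longrightarrow> T_map f \<cdot> inj X (D, g) = inj Y (D, f \<cdot> g)" by auto
qed

lemma
  assumes "X \<in> Obj B"
  shows T_counit_Hom: "T_counit X \<in> Hom B (T X) X"
    and T_counit_inj: "D \<in> K \<Longrightarrow> g \<in> Hom B D X \<Longrightarrow> T_counit X \<cdot> inj X (D, g) = g"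
proof -
  have "\<exists>m\<in>Hom B (T X) X. \<forall>D\<in>K. \<forall>g\<in>Hom B D X. m \<cdot> inj X (D, g) = g"
    using assms by (intro T_copair) auto
  then have "\<exists>m. m \<in> Hom B (T X) X \<and> (\<forall>D\<in>K. \<forall>g\<in>Hom B D X. m \<cdot> inj X (D, g) = g)"
    by blast
  from someI_ex[OF this, folded T_counit_def] show "T_counit X \<in> Hom B (T X) X"
    "D \<in> K \<Longrightarrow> g \<in> Hom B D X \<Longrightarrow> T_counit X \<cdot> inj X (D, g) = g" by auto
qed

lemma
  assumes "X \<in> Obj B"
  shows T_comult_Hom: "T_comult X \<in> Hom B (T X) (T (T X))"
    and T_comult_inj: "D \<in> K \<Longrightarrow> g \<in> Hom B D X \<Longrightarrow>
      T_comult X \<cdot> inj X (D, g) = inj (T X) (D, inj X (D, g))"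
proof -
  have "\<exists>m\<in>Hom B (T X) (T (T X)). \<forall>D\<in>K. \<forall>g\<in>Hom B D X.
      m \<cdot> inj X (D, g) = inj (T X) (D, inj X (D, g))"
    using assms by (intro T_copair) auto
  then have "\<exists>m. m \<in> Hom B (T X) (T (T X)) \<and> (\<forall>D\<in>K. \<forall>g\<in>Hom B D X.
      m \<cdot> inj X (D, g) = inj (T X) (D, inj X (D, g)))"
    by blast
  from someI_ex[OF this, folded T_comult_def] show "T_comult X \<in> Hom B (T X) (T (T X))"
    "D \<in> K \<Longrightarrow> g \<in> Hom B D X \<Longrightarrow> T_comult X \<cdot> inj X (D, g) = inj (T X) (D, inj X (D, g))"
    by auto
qed

lemma comp_inj:
  assumes "X \<in> Obj B" "Y \<in> Obj B" "Z \<in> Obj B" "p \<in> Hom B (T X) Y" "q \<in> Hom B Y Z"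
    "D \<in> K" "g \<in> Hom B D X"
  shows "(q \<cdot> p) \<cdot> inj X (D, g) = q \<cdot> (p \<cdot> inj X (D, g))"
  using assms by (intro comp_assoc[of D "T X" Y Z]) auto

text \<open>\<open>T_map f\<close> moves the summand \<open>(D, k)\<close> to the summand
  \<open>(D, f \<cdot> k)\<close>. Functoriality thus comes down to the unit and associativity laws
  of composition, applied to the indices.\<close>

lemma endofunctor_T: "endofunctor B T T_map"
  unfolding endofunctor_def
proof (intro conjI ballI)
  fix X assume X: "X \<in> Obj B"
  note id = category_id_Hom[OF category X]
  show "T_map (Id B X) = Id B (T X)"
  proof (rule T_ext[OF X T_Obj[OF X]])
    fix D g assume "D \<in> K" "g \<in> Hom B D X"
    with X id show "T_map (Id B X) \<cdot> inj X (D, g) = Id B (T X) \<cdot> inj X (D, g)"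
      using comp_id(2)[of D X g] comp_id(2)[of D "T X" "inj X (D, g)"]
      by (simp add: T_map_inj[of X X])
  qed (use X T_map_Hom[OF X X id] in \<open>auto intro: category_id_Hom[OF category]\<close>)
next
  fix X Y Z f g assume X: "X \<in> Obj B" and Y: "Y \<in> Obj B" and Z: "Z \<in> Obj B"
    and f: "f \<in> Hom B X Y" and g: "g \<in> Hom B Y Z"
  have gf: "g \<cdot> f \<in> Hom B X Z" using comp_Hom X Y Z f g by blast
  note Tf = T_map_Hom[OF X Y f] and Tg = T_map_Hom[OF Y Z g]
  show "T_map (g \<cdot> f) = T_map g \<cdot> T_map f"
  proof (rule T_ext[OF X T_Obj[OF Z]])
    fix D k assume D: "D \<in> K" and k: "k \<in> Hom B D X"
    have fk: "f \<cdot> k \<in> Hom B D Y" using comp_Hom X Y f D k by auto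
    have "T_map (g \<cdot> f) \<cdot> inj X (D, k) = inj Z (D, g \<cdot> (f \<cdot> k))"
      using X Y Z f g gf D k comp_assoc[of D X Y Z k f g] by (simp add: T_map_inj[of X Z])
    also have "\<dots> = T_map g \<cdot> (T_map f \<cdot> inj X (D, k))"
      using X Y Z f g D k fk by (simp add: T_map_inj[of X Y] T_map_inj[of Y Z])
    also have "\<dots> = (T_map g \<cdot> T_map f) \<cdot> inj X (D, k)"
      using X Y Z D k Tf Tg comp_inj[of X "T Y" "T Z"] by simp
    finally show "T_map (g \<cdot> f) \<cdot> inj X (D, k) = (T_map g \<cdot> T_map f) \<cdot> inj X (D, k)" .
  qed (use X Y Z T_map_Hom[OF X Z gf] Tf Tg comp_Hom[of "T X" "T Y" "T Z"] in auto)
qed (auto intro: T_map_Hom)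

text \<open>On the summand \<open>(D, k)\<close>, both sides of naturality become
  \<open>f \<cdot> k\<close> for the counit and the injection at
  \<open>(D, inj Y (D, f \<cdot> k))\<close> for the comultiplication. Both counit laws give back
  \<open>inj X (D, k)\<close>, and both sides of coassociativity give the threefold nested
  injection.\<close>

lemma comonad_T: "comonad B T_comonad"
  unfolding comonad_def Let_def T_comonad_def comonad_data.simps
proof (intro conjI ballI)
  fix X Y f assume X: "X \<in> Obj B" and Y: "Y \<in> Obj B" and f: "f \<in> Hom B X Y"
  note Tf = T_map_Hom[OF X Y f]
  note TTf = T_map_Hom[OF T_Obj[OF X] T_Obj[OF Y] Tf]
  note eX = T_counit_Hom[OF X] and eY = T_counit_Hom[OF Y]
  note dX = T_comult_Hom[OF X] and dY = T_comult_Hom[OF Y]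
  have fk: "f \<cdot> k \<in> Hom B D Y" if "D \<in> K" "k \<in> Hom B D X" for D k
    using comp_Hom X Y f that by auto
  show "T_counit Y \<cdot> T_map f = f \<cdot> T_counit X"
  proof (rule T_ext[OF X Y])
    fix D k assume D: "D \<in> K" and k: "k \<in> Hom B D X"
    have "(T_counit Y \<cdot> T_map f) \<cdot> inj X (D, k) = T_counit Y \<cdot> (T_map f \<cdot> inj X (D, k))"
      using X Y D k Tf eY comp_inj[of X "T Y" Y] by simp
    also have "\<dots> = f \<cdot> k"
      using X Y f D k fk by (simp add: T_map_inj[of X Y] T_counit_inj)
    also have "\<dots> = f \<cdot> (T_counit X \<cdot> inj X (D, k))"
      using X D k by (simp add: T_counit_inj)
    also have "\<dots> = (f \<cdot> T_counit X) \<cdot> inj X (D, k)"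
      using X Y D k f eX comp_inj[of X X Y] by simp
    finally show "(T_counit Y \<cdot> T_map f) \<cdot> inj X (D, k) = (f \<cdot> T_counit X) \<cdot> inj X (D, k)" .
  qed (use X Y f eX eY Tf comp_Hom[of "T X" X Y] comp_Hom[of "T X" "T Y" Y] in auto)
  show "T_comult Y \<cdot> T_map f = T_map (T_map f) \<cdot> T_comult X"
  proof (rule T_ext[OF X T_Obj[OF T_Obj[OF Y]]])
    fix D k assume D: "D \<in> K" and k: "k \<in> Hom B D X"
    have "(T_comult Y \<cdot> T_map f) \<cdot> inj X (D, k) = T_comult Y \<cdot> (T_map f \<cdot> inj X (D, k))"
      using X Y D k Tf dY comp_inj[of X "T Y" "T (T Y)"] by simp
    also have "\<dots> = inj (T Y) (D, inj Y (D, f \<cdot> k))"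
      using X Y f D k fk by (simp add: T_map_inj[of X Y] T_comult_inj)
    also have "\<dots> = T_map (T_map f) \<cdot> (T_comult X \<cdot> inj X (D, k))"
      using X Y D k f Tf by (simp add: T_comult_inj T_map_inj[of X Y] T_map_inj[of "T X" "T Y"])
    also have "\<dots> = (T_map (T_map f) \<cdot> T_comult X) \<cdot> inj X (D, k)"
      using X Y D k TTf dX comp_inj[of X "T (T X)" "T (T Y)"] by simp
    finally show "(T_comult Y \<cdot> T_map f) \<cdot> inj X (D, k) =
        (T_map (T_map f) \<cdot> T_comult X) \<cdot> inj X (D, k)" .
  qed (use X Y TTf dX dY Tf comp_Hom[of "T X" "T (T X)" "T (T Y)"]
        comp_Hom[of "T X" "T Y" "T (T Y)"] in auto)
next
  fix X assume X: "X \<in> Obj B"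
  note TX = T_Obj[OF X]
  note TTX = T_Obj[OF TX]
  note e = T_counit_Hom[OF X] and d = T_comult_Hom[OF X]
  note eT = T_counit_Hom[OF TX] and dT = T_comult_Hom[OF TX]
  note Te = T_map_Hom[OF TX X e] and Td = T_map_Hom[OF TX TTX d]
  note id = category_id_Hom[OF category TX]
  have idi: "Id B (T X) \<cdot> inj X (D, g) = inj X (D, g)" if "D \<in> K" "g \<in> Hom B D X" for D g
    using X that by (intro comp_id(2)[of D]) auto
  show "T_counit (T X) \<cdot> T_comult X = Id B (T X)"
  proof (rule T_ext[OF X TX])
    fix D k assume D: "D \<in> K" and k: "k \<in> Hom B D X"
    then show "(T_counit (T X) \<cdot> T_comult X) \<cdot> inj X (D, k) = Id B (T X) \<cdot> inj X (D, k)"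
      using X d eT comp_inj[of X "T (T X)" "T X"] by (simp add: T_comult_inj T_counit_inj idi)
  qed (use X id d eT comp_Hom[of "T X" "T (T X)" "T X"] in auto)
  show "T_map (T_counit X) \<cdot> T_comult X = Id B (T X)"
  proof (rule T_ext[OF X TX])
    fix D k assume D: "D \<in> K" and k: "k \<in> Hom B D X"
    then show "(T_map (T_counit X) \<cdot> T_comult X) \<cdot> inj X (D, k) = Id B (T X) \<cdot> inj X (D, k)"
      using X d e Te comp_inj[of X "T (T X)" "T X"]
      by (simp add: T_comult_inj T_counit_inj T_map_inj[of "T X" X] idi)
  qed (use X id d Te comp_Hom[of "T X" "T (T X)" "T X"] in auto)
  show "T_comult (T X) \<cdot> T_comult X = T_map (T_comult X) \<cdot> T_comult X"
  proof (rule T_ext[OF X T_Obj[OF TTX]])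
    fix D k assume D: "D \<in> K" and k: "k \<in> Hom B D X"
    then show "(T_comult (T X) \<cdot> T_comult X) \<cdot> inj X (D, k) =
        (T_map (T_comult X) \<cdot> T_comult X) \<cdot> inj X (D, k)"
      using X d Td dT comp_inj[of X "T (T X)" "T (T (T X))"]
      by (simp add: T_comult_inj T_map_inj[of "T X" "T (T X)"])
  qed (use X d Td dT comp_Hom[of "T X" "T (T X)" "T (T (T X))"] in auto)
qed (auto intro: endofunctor_T T_counit_Hom T_comult_Hom)

text \<open>For mutually inverse \<open>f\<close> from \<open>D\<close> to \<open>X\<close> and
  \<open>g\<close> back, the coalgebra is \<open>g\<close> followed by the injection of the summand
  \<open>(D, f)\<close>. The counit sends it to \<open>f \<cdot> g\<close>, the identity.\<close>

lemma coalgebra_if_isomorphic: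
  assumes "D \<in> K" "X \<in> Obj B" "isomorphic B D X"
  shows "\<exists>\<alpha>. coalgebra B T_comonad X \<alpha>"
proof -
  obtain f g where f: "f \<in> Hom B D X" and g: "g \<in> Hom B X D"
    and gf: "g \<cdot> f = Id B D" and fg: "f \<cdot> g = Id B X"
    using assms unfolding isomorphic_def by blast
  note D = assms(1) and X = assms(2)
  let ?a = "inj X (D, f) \<cdot> g"
  note TX = T_Obj[OF X]
  note TTX = T_Obj[OF TX]
  have i: "inj X (D, f) \<in> Hom B D (T X)" using X D f by simp
  have a: "?a \<in> Hom B X (T X)" using X D i g comp_Hom[of X D "T X"] by simp
  \<comment> \<open>Coassociativity rests on this equation: the comultiplication has the index
    \<open>inj X (D, f)\<close>, while \<open>T_map ?a\<close> produces the index
    \<open>?a \<cdot> f\<close>.\<close>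
  have af: "?a \<cdot> f = inj X (D, f)"
    using X D f g i gf comp_assoc[of D X D "T X" f g] comp_id(1)[of D "T X" "inj X (D, f)"] by simp
  have e: "T_counit X \<cdot> ?a = Id B X"
    using X D f g i fg T_counit_Hom[OF X] comp_assoc[of X D "T X" X g "inj X (D, f)", symmetric]
    by (simp add: T_counit_inj)
  have "T_comult X \<cdot> ?a = inj (T X) (D, inj X (D, f)) \<cdot> g"
    using X D f g i T_comult_Hom[OF X] comp_assoc[of X D "T X" "T (T X)" g "inj X (D, f)", symmetric]
    by (simp add: T_comult_inj)
  also have "\<dots> = (T_map ?a \<cdot> inj X (D, f)) \<cdot> g"
    using X D f a af by (simp add: T_map_inj[of X "T X"])
  also have "\<dots> = T_map ?a \<cdot> ?a"
    using X D g i T_map_Hom[OF X TX a] by (intro comp_assoc[of X D "T X" "T (T X)"]) auto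
  finally have "coalgebra B T_comonad X ?a"
    using a e by (simp add: coalgebra_def T_comonad_def)
  then show ?thesis ..
qed

end

section \<open>Small sets\<close>

lemma lepoll_card_of: "A \<lesssim> B \<longleftrightarrow> ordLeq2 (card_of A) (card_of B)"
  by (simp add: lepoll_def card_of_ordLeq)

lemma Sigma_lepoll_infinite:
  assumes "infinite C" "I \<lesssim> C" "\<And>i. i \<in> I \<Longrightarrow> A i \<lesssim> C"
  shows "Sigma I A \<lesssim> C"
  using assms card_of_Sigma_ordLeq_infinite[of C I A] by (simp add: lepoll_card_of)

lemma UN_lepoll_infinite:
  assumes "infinite C" "I \<lesssim> C" "\<And>i. i \<in> I \<Longrightarrow> A i \<lesssim> C"
  shows "(\<Union>i\<in>I. A i) \<lesssim> C"
  using assms card_of_UNION_ordLeq_infinite[of C I A] by (simp add: lepoll_card_of)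

lemma Pow_lepoll_mono:
  assumes "A \<lesssim> B"
  shows "Pow A \<lesssim> Pow B"
proof -
  obtain f where "inj_on f A" "f ` A \<subseteq> B" using assms unfolding lepoll_def by blast
  then show ?thesis
    unfolding lepoll_def by (intro exI[of _ "image f"]) (auto intro: inj_on_image_Pow)
qed

text \<open>Induction on \<open>P\<close>: a function on \<open>insert x P\<close> is a value at
  \<open>x\<close> together with a function on \<open>P\<close>, and an infinite set absorbs the
  binary product.\<close>

lemma PiE_lepoll_infinite:
  assumes "infinite C" "finite P" "A \<lesssim> C"
  shows "(P \<rightarrow>\<^sub>E A) \<lesssim> C"
  using assms(2)
proof induction
  case empty
  show ?case using assms(1) by (simp add: finite_lepoll_infinite)
next
  case (insert x P)
  have "(insert x P \<rightarrow>\<^sub>E A) \<lesssim> A \<times> (P \<rightarrow>\<^sub>E A)"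
    unfolding PiE_insert_eq by (rule image_lepoll)
  also have "\<dots> \<lesssim> C"
    using assms(1,3) insert.IH by (intro Sigma_lepoll_infinite) auto
  finally show ?case .
qed

lemma smallness_lepoll: "smallness U \<Longrightarrow> A \<in> U \<Longrightarrow> B \<lesssim> A \<Longrightarrow> B \<in> U"
  unfolding smallness_def by blast

text \<open>Cardinals are totally ordered, so one of two members of \<open>U\<close> bounds both.
  Comparing that one with an infinite member makes the bound infinite.\<close>

lemma smallness_upper_bound:
  assumes "smallness U" "A \<in> U" "B \<in> U"
  obtains C where "C \<in> U" "infinite C" "A \<lesssim> C" "B \<lesssim> C"
proof -
  have total: "\<exists>C\<in>U. A \<lesssim> C \<and> B \<lesssim> C" if "A \<in> U" "B \<in> U" for A B
    using that ordLeq_total[OF card_of_Well_order card_of_Well_order, of A B]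
    by (auto simp: lepoll_card_of[symmetric])
  obtain N where N: "N \<in> U" "infinite N" using assms(1) unfolding smallness_def by blast
  obtain C where C: "C \<in> U" "A \<lesssim> C" "B \<lesssim> C" using total assms by blast
  obtain C' where "C' \<in> U" "N \<lesssim> C'" "C \<lesssim> C'" using total N C by blast
  then show ?thesis using that[of C'] N C lepoll_trans by (meson infinite_le_lepoll)
qed

lemma smallness_finite:
  assumes "smallness U" "finite A"
  shows "A \<in> U"
  using assms finite_lepoll_infinite unfolding smallness_def by blast

section \<open>Categories of relational structures\<close>

text \<open>A common frame for relational structures and graphs; \<open>rel A R\<close> is the set of \<open>R\<close>-tuples of
  \<open>A\<close>. That tuples are non-empty makes \<open>disjoint_union\<close> describe coproducts.\<close>

locale relational_category =
  fixes U :: "'u set set" and Obs :: "'o set" and pts :: "'o \<Rightarrow> 'u set"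
    and \<sigma> :: "'r set" and rel :: "'o \<Rightarrow> 'r \<Rightarrow> 'u list set"
  assumes smallness: "smallness U"
    and pts_small: "A \<in> Obs \<Longrightarrow> pts A \<in> U"
    and rel_pts: "A \<in> Obs \<Longrightarrow> R \<in> \<sigma> \<Longrightarrow> xs \<in> rel A R \<Longrightarrow> xs \<noteq> [] \<and> set xs \<subseteq> pts A"
    and disjoint_unions: "\<And>(I :: ('o \<times> 'o \<times> ('u \<Rightarrow> 'u) \<times> 'o) set) A \<iota>.
      (\<And>i. i \<in> I \<Longrightarrow> A i \<in> Obs) \<Longrightarrow> inj_on (\<lambda>(i, y). \<iota> i y) (SIGMA i:I. pts (A i)) \<Longrightarrow>
      (\<Union>i\<in>I. \<iota> i ` pts (A i)) \<in> U \<Longrightarrow>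
      \<exists>S\<in>Obs. pts S = (\<Union>i\<in>I. \<iota> i ` pts (A i)) \<and>
        (\<forall>R\<in>\<sigma>. rel S R = (\<Union>i\<in>I. map (\<iota> i) ` rel (A i) R))"
    and few_structures: "\<exists>C\<in>U. \<forall>P. finite P \<longrightarrow> {D \<in> Obs. pts D = P} \<lesssim> C"
begin

section \<open>Morphisms and the category laws\<close>

definition hom :: "'o \<Rightarrow> 'o \<Rightarrow> ('u \<Rightarrow> 'u) set" where
  "hom A B = {f \<in> pts A \<rightarrow>\<^sub>E pts B. \<forall>R\<in>\<sigma>. \<forall>xs\<in>rel A R. map f xs \<in> rel B R}"

text \<open>In the two instances below this is literally \<open>Struct_cat U \<sigma> ar\<close> and
  \<open>Graph_cat U\<close>, so results carry over by rewriting.\<close>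

definition rcat :: "('o, 'o \<times> ('u \<Rightarrow> 'u) \<times> 'o) cat" where
  "rcat = \<lparr>Obj = Obs, Hom = (\<lambda>A B. {(A, f, B) | f. f \<in> hom A B}),
     Id = arrow_id pts, Comp = arrow_comp pts\<rparr>"

definition app :: "'o \<times> ('u \<Rightarrow> 'u) \<times> 'o \<Rightarrow> 'u \<Rightarrow> 'u" where
  "app m = fst (snd m)"

lemma Obj_rcat [simp]: "Obj rcat = Obs"
  by (simp add: rcat_def)

lemma Hom_iff: "m \<in> Hom rcat A B \<longleftrightarrow> m = (A, app m, B) \<and> app m \<in> hom A B"
  by (cases m) (auto simp: rcat_def app_def)

lemma Hom_app: "m \<in> Hom rcat A B \<Longrightarrow> x \<in> pts A \<Longrightarrow> app m x \<in> pts B"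
  by (auto simp: Hom_iff hom_def)

lemma Hom_rel: "m \<in> Hom rcat A B \<Longrightarrow> R \<in> \<sigma> \<Longrightarrow> xs \<in> rel A R \<Longrightarrow> map (app m) xs \<in> rel B R"
  by (auto simp: Hom_iff hom_def)

lemma Hom_eqI:
  assumes "m \<in> Hom rcat A B" "n \<in> Hom rcat A B" "\<And>x. x \<in> pts A \<Longrightarrow> app m x = app n x"
  shows "m = n"
proof -
  have "app m = app n"
    using assms by (intro PiE_ext[of _ "pts A" "\<lambda>_. pts B"]) (auto simp: Hom_iff hom_def)
  then show ?thesis using assms(1,2) by (metis Hom_iff)
qed

text \<open>Restriction makes \<open>f\<close> extensional, as morphisms must be. It does not change
  the images of tuples, whose entries lie in \<open>pts A\<close>.\<close>

lemma Hom_restrictI: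
  assumes "A \<in> Obs" "\<And>x. x \<in> pts A \<Longrightarrow> f x \<in> pts B"
    "\<And>R xs. R \<in> \<sigma> \<Longrightarrow> xs \<in> rel A R \<Longrightarrow> map f xs \<in> rel B R"
  shows "(A, restrict f (pts A), B) \<in> Hom rcat A B"
proof -
  have "map (restrict f (pts A)) xs = map f xs" if "R \<in> \<sigma>" "xs \<in> rel A R" for R xs
    using rel_pts[OF assms(1) that] by auto
  then have "map (restrict f (pts A)) xs \<in> rel B R" if "R \<in> \<sigma>" "xs \<in> rel A R" for R xs
    using assms(3) that by metis
  with assms(2) have "restrict f (pts A) \<in> hom A B" by (auto simp: hom_def)
  then show ?thesis by (simp add: Hom_iff app_def)
qed

lemma app_restrict [simp]: "x \<in> P \<Longrightarrow> app (A, restrict f P, B) x = f x"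
  by (simp add: app_def)

lemma app_comp: "m \<in> Hom rcat A B \<Longrightarrow> x \<in> pts A \<Longrightarrow> app (n \<cdot>\<^bsub>rcat\<^esub> m) x = app n (app m x)"
  by (cases n) (auto simp: Hom_iff rcat_def arrow_comp_def app_def compose_def)

lemma app_Id [simp]: "x \<in> pts A \<Longrightarrow> app (Id rcat A) x = x"
  by (simp add: rcat_def arrow_id_def app_def)

lemma Id_Hom: "A \<in> Obs \<Longrightarrow> Id rcat A \<in> Hom rcat A A"
  using Hom_restrictI[of A "\<lambda>x. x" A] by (simp add: rcat_def arrow_id_def)

lemma comp_Hom:
  assumes "A \<in> Obs" "f \<in> Hom rcat A B" "g \<in> Hom rcat B C"
  shows "g \<cdot>\<^bsub>rcat\<^esub> f \<in> Hom rcat A C"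
proof -
  have "g \<cdot>\<^bsub>rcat\<^esub> f = (A, restrict (\<lambda>x. app g (app f x)) (pts A), C)"
    using assms by (cases f, cases g) (auto simp: Hom_iff rcat_def arrow_comp_def app_def compose_def)
  moreover have "map (\<lambda>x. app g (app f x)) xs \<in> rel C R" if "R \<in> \<sigma>" "xs \<in> rel A R" for R xs
    using Hom_rel[OF assms(3) that(1) Hom_rel[OF assms(2) that]] by (simp add: comp_def)
  ultimately show ?thesis
    using assms by (auto intro!: Hom_restrictI Hom_app[OF assms(3)] Hom_app[OF assms(2)])
qed

lemma category_rcat: "category rcat"
  unfolding category_def
proof (intro conjI ballI)
  fix X Y f assume X: "X \<in> Obj rcat" "Y \<in> Obj rcat" and f: "f \<in> Hom rcat X Y"
  note iX = Id_Hom[OF X(1)[simplified]]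
  show "f \<cdot>\<^bsub>rcat\<^esub> Id rcat X = f" "Id rcat Y \<cdot>\<^bsub>rcat\<^esub> f = f"
    using X f iX
    by (auto intro!: Hom_eqI[of _ X Y] comp_Hom[OF _ iX f] comp_Hom[OF _ f] Id_Hom
        simp: app_comp[OF iX] app_comp[OF f] Hom_app[OF f])
next
  fix W X Y Z f g h assume "W \<in> Obj rcat" "X \<in> Obj rcat" "Y \<in> Obj rcat" "Z \<in> Obj rcat"
    and fgh: "f \<in> Hom rcat W X" "g \<in> Hom rcat X Y" "h \<in> Hom rcat Y Z"
  then have o: "W \<in> Obs" "X \<in> Obs" by auto
  note gf = comp_Hom[OF o(1) fgh(1,2)] and hg = comp_Hom[OF o(2) fgh(2,3)]
  show "h \<cdot>\<^bsub>rcat\<^esub> (g \<cdot>\<^bsub>rcat\<^esub> f) = (h \<cdot>\<^bsub>rcat\<^esub> g) \<cdot>\<^bsub>rcat\<^esub> f"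
    using o fgh gf hg
    by (intro Hom_eqI[of _ W Z] comp_Hom[of W _ Y] comp_Hom[of W _ X])
      (auto simp: app_comp[OF gf] app_comp[OF fgh(1)] app_comp[OF fgh(2)] Hom_app[OF fgh(1)])
next
  fix X Y X' Y'
  show "Hom rcat X Y \<inter> Hom rcat X' Y' \<noteq> {} \<longrightarrow> X = X' \<and> Y = Y'"
    by (auto simp: Hom_iff)
qed (auto intro: Id_Hom comp_Hom)

section \<open>Disjoint unions and their universal property\<close>

definition disjoint_union :: "'i set \<Rightarrow> ('i \<Rightarrow> 'o) \<Rightarrow> 'o \<Rightarrow> ('i \<Rightarrow> 'u \<Rightarrow> 'u) \<Rightarrow> bool" where
  "disjoint_union I A S \<iota> \<longleftrightarrow> S \<in> Obs \<and> (\<forall>i\<in>I. A i \<in> Obs) \<and>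
     inj_on (\<lambda>(i, y). \<iota> i y) (SIGMA i:I. pts (A i)) \<and> pts S = (\<Union>i\<in>I. \<iota> i ` pts (A i)) \<and>
     (\<forall>R\<in>\<sigma>. rel S R = (\<Union>i\<in>I. map (\<iota> i) ` rel (A i) R))"

text \<open>The values of \<open>\<iota> i\<close> outside \<open>pts (A i)\<close> are arbitrary;
  restricting turns this bare function into the data of a morphism.\<close>

definition injection :: "('i \<Rightarrow> 'o) \<Rightarrow> 'o \<Rightarrow> ('i \<Rightarrow> 'u \<Rightarrow> 'u) \<Rightarrow> 'i \<Rightarrow> 'o \<times> ('u \<Rightarrow> 'u) \<times> 'o" where
  "injection A S \<iota> i = (A i, restrict (\<iota> i) (pts (A i)), S)"

text \<open>Joint injectivity on the \<open>SIGMA\<close> set expresses two facts at once: each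
  \<open>\<iota> i\<close> is injective, and the images of different summands are disjoint.\<close>

lemma disjoint_union_eq:
  assumes "disjoint_union I A S \<iota>" "i \<in> I" "j \<in> I" "y \<in> pts (A i)" "z \<in> pts (A j)"
    "\<iota> i y = \<iota> j z"
  shows "i = j" "y = z"
proof -
  have "inj_on (\<lambda>(i, y). \<iota> i y) (SIGMA i:I. pts (A i))"
    using assms(1) by (simp add: disjoint_union_def)
  then have "(i, y) = (j, z)" using assms(2-) by (elim inj_onD) auto
  then show "i = j" "y = z" by auto
qed

lemma injection_Hom:
  assumes "disjoint_union I A S \<iota>" "i \<in> I"
  shows "injection A S \<iota> i \<in> Hom rcat (A i) S"
  unfolding injection_def using assms
  by (intro Hom_restrictI) (auto simp: disjoint_union_def)

lemma app_injection [simp]: "y \<in> pts (A i) \<Longrightarrow> app (injection A S \<iota> i) y = \<iota> i y"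
  by (simp add: injection_def)

text \<open>Every tuple of \<open>S\<close> comes from a single summand, so \<open>a\<close> sends
  each tuple of \<open>X\<close> into one summand, where a single \<open>g j\<close> preserves it.
  With \<open>a\<close> the identity this gives the universal property of \<open>S\<close>; with
  \<open>a\<close> a coalgebra and \<open>J\<close> the summands that it meets, it gives that of
  \<open>X\<close>.\<close>

lemma disjoint_union_factor:
  assumes S: "disjoint_union I A S \<iota>" and X: "X \<in> Obs" and Y: "Y \<in> Obs"
    and a: "a \<in> Hom rcat X S" and J: "J \<subseteq> I"
    and cover: "\<And>x. x \<in> pts X \<Longrightarrow> \<exists>j\<in>J. \<exists>y\<in>pts (A j). app a x = \<iota> j y"
    and g: "\<And>j. j \<in> J \<Longrightarrow> g j \<in> Hom rcat (A j) Y"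
  shows "\<exists>h\<in>Hom rcat X Y. \<forall>x\<in>pts X. \<forall>j\<in>J. \<forall>y\<in>pts (A j).
    app a x = \<iota> j y \<longrightarrow> app h x = app (g j) y"
proof -
  \<comment> \<open>Inverting the joint injection reads off from \<open>app a x\<close> its summand
    and its point there, to which \<open>g\<close> is then applied.\<close>
  define h where "h x = (\<lambda>(j, y). app (g j) y)
    (inv_into (SIGMA j:I. pts (A j)) (\<lambda>(j, y). \<iota> j y) (app a x))" for x
  have inj: "inj_on (\<lambda>(j, y). \<iota> j y) (SIGMA j:I. pts (A j))"
    using S by (simp add: disjoint_union_def)
  have h: "h x = app (g j) y" if "app a x = \<iota> j y" "j \<in> J" "y \<in> pts (A j)" for x j y
    using that J inv_into_f_f[OF inj, of "(j, y)"] by (auto simp: h_def)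
  have "(X, restrict h (pts X), Y) \<in> Hom rcat X Y"
  proof (rule Hom_restrictI[OF X])
    fix x assume "x \<in> pts X"
    then show "h x \<in> pts Y" using cover h Hom_app[OF g] by metis
  next
    fix R xs assume R: "R \<in> \<sigma>" and xs: "xs \<in> rel X R"
    have "map (app a) xs \<in> rel S R" using Hom_rel[OF a R xs] .
    then obtain i ys where i: "i \<in> I" and ys: "ys \<in> rel (A i) R"
      and eq: "map (app a) xs = map (\<iota> i) ys"
      using S R unfolding disjoint_union_def by auto
    have A: "A i \<in> Obs" using S i by (simp add: disjoint_union_def)
    have xs': "xs \<noteq> []" "set xs \<subseteq> pts X" using rel_pts[OF X R xs] by auto
    have ys': "set ys \<subseteq> pts (A i)" using rel_pts[OF A R ys] by auto
    have len: "length xs = length ys" using eq map_eq_imp_length_eq by blast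
    have nth: "app a (xs ! k) = \<iota> i (ys ! k)" "ys ! k \<in> pts (A i)" if "k < length xs" for k
      using that len ys' arg_cong[OF eq, of "\<lambda>l. l ! k"] nth_mem[of k ys] by auto
    \<comment> \<open>Tuples are non-empty, so a first entry exists. The summand in which it is
      covered lies in \<open>J\<close> and, by disjointness, is the summand \<open>i\<close> of the
      whole tuple.\<close>
    have x0: "xs ! 0 \<in> pts X" using xs' nth_mem[of 0 xs] by auto
    then obtain j z where j: "j \<in> J" "z \<in> pts (A j)" "app a (xs ! 0) = \<iota> j z"
      using cover by blast
    have "i = j"
      using disjoint_union_eq(1)[OF S i, of j "ys ! 0" z] J j nth[of 0] xs' by auto
    then have iJ: "i \<in> J" using j by simp
    have "map h xs = map (app (g i)) ys"
      using h[OF nth(1) iJ nth(2)] len by (intro nth_equalityI) auto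
    then show "map h xs \<in> rel Y R" using Hom_rel[OF g[OF iJ] R ys] by simp
  qed
  then show ?thesis using h by (intro bexI) auto
qed

text \<open>Existence is the factorisation lemma for the identity of \<open>S\<close>; uniqueness
  holds because the images of the summands cover \<open>S\<close>.\<close>

lemma disjoint_union_coproduct:
  assumes S: "disjoint_union I A S \<iota>"
  shows "is_coproduct rcat I A S (injection A S \<iota>)"
  unfolding is_coproduct_def
proof (intro conjI ballI allI impI)
  show SO: "S \<in> Obj rcat" using S by (simp add: disjoint_union_def)
  show "A i \<in> Obj rcat" if "i \<in> I" for i
    using S that by (simp add: disjoint_union_def)
  show "injection A S \<iota> i \<in> Hom rcat (A i) S" if "i \<in> I" for i
    using injection_Hom[OF S that] .
  fix Y f assume Y: "Y \<in> Obj rcat" and f: "\<forall>i\<in>I. f i \<in> Hom rcat (A i) Y"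
  have cover: "\<exists>i\<in>I. \<exists>y\<in>pts (A i). s = \<iota> i y" if "s \<in> pts S" for s
    using S that by (auto simp: disjoint_union_def)
  have "\<exists>h\<in>Hom rcat S Y. \<forall>x\<in>pts S. \<forall>j\<in>I. \<forall>y\<in>pts (A j).
      app (Id rcat S) x = \<iota> j y \<longrightarrow> app h x = app (f j) y"
    using SO Y f cover by (intro disjoint_union_factor[OF S]) (auto intro: Id_Hom)
  then obtain h where h: "h \<in> Hom rcat S Y"
    and hf: "\<And>j y. j \<in> I \<Longrightarrow> y \<in> pts (A j) \<Longrightarrow> \<iota> j y \<in> pts S \<Longrightarrow> app h (\<iota> j y) = app (f j) y"
    by auto
  have ip: "\<iota> j y \<in> pts S" if "j \<in> I" "y \<in> pts (A j)" for j y
    using S that by (auto simp: disjoint_union_def)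
  show "\<exists>!h. h \<in> Hom rcat S Y \<and> (\<forall>i\<in>I. h \<cdot>\<^bsub>rcat\<^esub> injection A S \<iota> i = f i)"
  proof (intro ex1I conjI ballI)
    show "h \<in> Hom rcat S Y" by fact
    show "h \<cdot>\<^bsub>rcat\<^esub> injection A S \<iota> i = f i" if i: "i \<in> I" for i
    proof (rule Hom_eqI)
      have "A i \<in> Obs" using S i by (simp add: disjoint_union_def)
      then show "h \<cdot>\<^bsub>rcat\<^esub> injection A S \<iota> i \<in> Hom rcat (A i) Y"
        using injection_Hom[OF S i] h comp_Hom by blast
    qed (use f i hf ip app_comp[OF injection_Hom[OF S i]] in auto)
  next
    fix h' assume h': "h' \<in> Hom rcat S Y \<and> (\<forall>i\<in>I. h' \<cdot>\<^bsub>rcat\<^esub> injection A S \<iota> i = f i)"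
    show "h' = h"
    proof (rule Hom_eqI)
      fix s assume s: "s \<in> pts S"
      then obtain i y where i: "i \<in> I" and y: "y \<in> pts (A i)" "s = \<iota> i y" using cover by blast
      then have "app h' s = app (h' \<cdot>\<^bsub>rcat\<^esub> injection A S \<iota> i) y"
        using app_comp[OF injection_Hom[OF S i]] by simp
      then show "app h' s = app h s" using h' i y s hf by simp
    qed (use h h' in auto)
  qed
qed

lemma isomorphic_sym: "isomorphic rcat X Y \<Longrightarrow> isomorphic rcat Y X"
  unfolding isomorphic_def by blast

text \<open>This serves to move a finite object onto a standard carrier, by pushing its relations
  forward along the injection \<open>b\<close>.\<close>

lemma transport:
  assumes X: "X \<in> Obs" and b: "inj_on b (pts X)" and P: "b ` pts X \<in> U"
  obtains D where "D \<in> Obs" "pts D = b ` pts X" "isomorphic rcat X D"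
proof -
  \<comment> \<open>A renaming is a disjoint union with one summand; \<open>undefined\<close> is an
    arbitrary index of the type that \<open>disjoint_unions\<close> prescribes.\<close>
  have "inj_on (\<lambda>(i, y). b y) (SIGMA i:{undefined :: 'o \<times> 'o \<times> ('u \<Rightarrow> 'u) \<times> 'o}. pts X)"
    using b by (auto simp: inj_on_def)
  then obtain D where D: "D \<in> Obs" "pts D = b ` pts X" "\<And>R. R \<in> \<sigma> \<Longrightarrow> rel D R = map b ` rel X R"
    using disjoint_unions[of "{undefined}" "\<lambda>_. X" "\<lambda>_. b"] X P by auto
  let ?f = "(X, restrict b (pts X), D)" and ?g = "(D, restrict (inv_into (pts X) b) (b ` pts X), X)"
  have inv: "map (inv_into (pts X) b) (map b xs) = xs" if "R \<in> \<sigma>" "xs \<in> rel X R" for R xs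
    using rel_pts[OF X that] b by (auto intro!: map_idI)
  have f: "?f \<in> Hom rcat X D" using X D by (intro Hom_restrictI) auto
  have "(D, restrict (inv_into (pts X) b) (pts D), X) \<in> Hom rcat D X"
  proof (rule Hom_restrictI)
    fix R ys assume R: "R \<in> \<sigma>" "ys \<in> rel D R"
    then obtain xs where "xs \<in> rel X R" "ys = map b xs" using D by auto
    then show "map (inv_into (pts X) b) ys \<in> rel X R" using inv R by metis
  qed (use D inv_into_into[of _ b "pts X"] in auto)
  then have g: "?g \<in> Hom rcat D X" using D(2) by simp
  have "?g \<cdot>\<^bsub>rcat\<^esub> ?f = Id rcat X"
    using X D b f g by (intro Hom_eqI[of _ X X] comp_Hom Id_Hom) (auto simp: app_comp[OF f])
  moreover have "?f \<cdot>\<^bsub>rcat\<^esub> ?g = Id rcat D"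
    using X D b f g by (intro Hom_eqI[of _ D D] comp_Hom Id_Hom) (auto simp: app_comp[OF g])
  ultimately have "isomorphic rcat X D" using f g unfolding isomorphic_def by blast
  then show ?thesis using that D by blast
qed

text \<open>An injection \<open>c\<close> of the sum of the carriers into \<open>C\<close> supplies
  pairwise disjoint copies of them. Their union is a subset of \<open>C\<close> and hence
  small.\<close>

lemma disjoint_union_exists:
  fixes I :: "('o \<times> 'o \<times> ('u \<Rightarrow> 'u) \<times> 'o) set"
  assumes "\<And>i. i \<in> I \<Longrightarrow> A i \<in> Obs" "C \<in> U" "(SIGMA i:I. pts (A i)) \<lesssim> C"
  shows "\<exists>S \<iota>. disjoint_union I A S \<iota>"
proof -
  obtain c where c: "inj_on c (SIGMA i:I. pts (A i))" "c ` (SIGMA i:I. pts (A i)) \<subseteq> C"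
    using assms(3) unfolding lepoll_def by blast
  have "(\<Union>i\<in>I. (\<lambda>y. c (i, y)) ` pts (A i)) = c ` (SIGMA i:I. pts (A i))" by force
  then have "(\<Union>i\<in>I. (\<lambda>y. c (i, y)) ` pts (A i)) \<in> U"
    using c(2) assms(2) smallness_lepoll[OF smallness] subset_imp_lepoll by metis
  then have "\<exists>S\<in>Obs. pts S = (\<Union>i\<in>I. (\<lambda>y. c (i, y)) ` pts (A i)) \<and>
        (\<forall>R\<in>\<sigma>. rel S R = (\<Union>i\<in>I. map (\<lambda>y. c (i, y)) ` rel (A i) R))"
    using assms(1) c(1) by (intro disjoint_unions) (auto simp: case_prod_beta')
  then obtain S where "disjoint_union I A S (\<lambda>i y. c (i, y))"
    using assms(1) c(1) unfolding disjoint_union_def by (auto simp: case_prod_beta')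
  then show ?thesis by blast
qed

end

section \<open>Coalgebras as disjoint unions\<close>

text \<open>The objects \<open>T X\<close> are given as concrete disjoint unions and not merely as
  coproducts, because coalgebras are analysed through the points that they hit.\<close>

locale relational_family = relational_category U Obs pts \<sigma> rel
  for U :: "'u set set" and Obs :: "'o set" and pts and \<sigma> :: "'r set" and rel +
  fixes K :: "'o set" and T :: "'o \<Rightarrow> 'o"
    and \<iota> :: "'o \<Rightarrow> 'o \<times> 'o \<times> ('u \<Rightarrow> 'u) \<times> 'o \<Rightarrow> 'u \<Rightarrow> 'u"
  assumes K: "K \<subseteq> Obs"
    and union: "X \<in> Obs \<Longrightarrow> disjoint_union (SIGMA D:K. Hom rcat D X) fst (T X) (\<iota> X)"
begin

sublocale C: family_coproducts rcat K T "\<lambda>X. injection fst (T X) (\<iota> X)"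
  by unfold_locales (use K union in \<open>auto intro: category_rcat disjoint_union_coproduct\<close>)

context
  fixes X \<alpha>
  assumes X: "X \<in> Obs" and coalg: "coalgebra rcat C.T_comonad X \<alpha>"
begin

definition pieces :: "('o \<times> 'o \<times> ('u \<Rightarrow> 'u) \<times> 'o) set" where
  "pieces = {i \<in> SIGMA D:K. Hom rcat D X. \<exists>x\<in>pts X. \<exists>y\<in>pts (fst i). app \<alpha> x = \<iota> X i y}"

lemma coalg_Hom: "\<alpha> \<in> Hom rcat X (T X)"
  using coalg by (simp add: coalgebra_def C.T_comonad_def)

lemma T_Obs: "T X \<in> Obs"
  using C.T_Obj[of X] X by simp

lemma coalg_cases:
  assumes "x \<in> pts X"
  obtains i y where "i \<in> pieces" "y \<in> pts (fst i)" "app \<alpha> x = \<iota> X i y"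
proof -
  have "app \<alpha> x \<in> pts (T X)" using Hom_app[OF coalg_Hom assms] .
  then have "\<exists>i\<in>SIGMA D:K. Hom rcat D X. \<exists>y\<in>pts (fst i). app \<alpha> x = \<iota> X i y"
    using union[OF X] unfolding disjoint_union_def by auto
  then show ?thesis using that assms unfolding pieces_def by blast
qed

lemma counit_coalg:
  assumes "x \<in> pts X"
  shows "app (C.T_counit X) (app \<alpha> x) = x"
proof -
  have "C.T_counit X \<cdot>\<^bsub>rcat\<^esub> \<alpha> = Id rcat X"
    using coalg by (simp add: coalgebra_def C.T_comonad_def)
  then show ?thesis using app_comp[OF coalg_Hom assms, of "C.T_counit X"] assms by simp
qed

lemma app_inj:
  assumes "D \<in> K" "g \<in> Hom rcat D X" "y \<in> pts D"
  shows "app (m \<cdot>\<^bsub>rcat\<^esub> injection fst (T X) (\<iota> X) (D, g)) y = app m (\<iota> X (D, g) y)"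
  using app_comp[OF C.inj_Hom, of X D g y m] assms X by simp

text \<open>The counit is a left inverse of \<open>\<alpha>\<close> and acts on the summand
  \<open>i\<close> as \<open>snd i\<close>.\<close>

lemma counit_piece:
  assumes "x \<in> pts X" "i \<in> pieces" "y \<in> pts (fst i)" "app \<alpha> x = \<iota> X i y"
  shows "x = app (snd i) y"
proof -
  obtain D g where i: "i = (D, g)" "D \<in> K" "g \<in> Hom rcat D X"
    using assms(2) unfolding pieces_def by auto
  have "app (C.T_counit X) (\<iota> X i y) = app g y"
    using app_inj[OF i(2,3), of y "C.T_counit X"] C.T_counit_inj[of X D g] i X assms(3) by simp
  then show ?thesis using counit_coalg[OF assms(1)] assms(4) i by simp
qed

text \<open>Comparing the two sides of coassociativity in the summands of \<open>T (T X)\<close> shows that \<open>\<alpha>\<close>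
  maps each piece identically onto its summand of \<open>T X\<close>.\<close>

lemma coalg_piece:
  assumes i: "i \<in> pieces" and z: "z \<in> pts (fst i)"
  shows "app \<alpha> (app (snd i) z) = \<iota> X i z"
proof -
  obtain D g x y where ig: "i = (D, g)" and D: "D \<in> K" and g: "g \<in> Hom rcat D X"
    and x: "x \<in> pts X" and y: "y \<in> pts D" and eq: "app \<alpha> x = \<iota> X (D, g) y"
    using i unfolding pieces_def by auto
  let ?i = "injection fst (T X) (\<iota> X) (D, g)"
  have DO: "D \<in> Obs" using D K by auto
  have inj: "?i \<in> Hom rcat D (T X)" using C.inj_Hom[of X D g] X D g by simp
  have ag: "\<alpha> \<cdot>\<^bsub>rcat\<^esub> g \<in> Hom rcat D (T X)" using comp_Hom[OF DO g coalg_Hom] .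
  have "C.T_comult X \<cdot>\<^bsub>rcat\<^esub> \<alpha> = C.T_map \<alpha> \<cdot>\<^bsub>rcat\<^esub> \<alpha>"
    using coalg by (simp add: coalgebra_def C.T_comonad_def)
  then have "app (C.T_comult X) (\<iota> X (D, g) y) = app (C.T_map \<alpha>) (\<iota> X (D, g) y)"
    using app_comp[OF coalg_Hom x, of "C.T_comult X"] app_comp[OF coalg_Hom x, of "C.T_map \<alpha>"] eq
    by simp
  moreover have "app (C.T_comult X) (\<iota> X (D, g) y) = \<iota> (T X) (D, ?i) y"
    using app_inj[OF D g y, of "C.T_comult X"] C.T_comult_inj[of X D g] X D g y by simp
  moreover have "app (C.T_map \<alpha>) (\<iota> X (D, g) y) = \<iota> (T X) (D, \<alpha> \<cdot>\<^bsub>rcat\<^esub> g) y"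
    using app_inj[OF D g y, of "C.T_map \<alpha>"] C.T_map_inj[of X "T X" \<alpha> D g] X T_Obs coalg_Hom D g y
    by simp
  \<comment> \<open>One common point suffices: disjointness of the summands of
    \<open>T (T X)\<close> turns an equation between points into an equation between the index
    morphisms, which then agree on all of \<open>D\<close>.\<close>
  ultimately have "(D, ?i) = (D, \<alpha> \<cdot>\<^bsub>rcat\<^esub> g)"
    using D inj ag y by (intro disjoint_union_eq(1)[OF union[OF T_Obs]]) auto
  then have "app (\<alpha> \<cdot>\<^bsub>rcat\<^esub> g) z = app ?i z" by simp
  then show ?thesis using app_comp[OF g] z ig by simp
qed

text \<open>Every piece is met by some point and every point lands in only one piece, so sending a
  point to its piece is onto.\<close>

lemma finite_pieces:
  assumes "finite (pts X)"
  shows "finite pieces"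
proof -
  have "\<exists>i. i \<in> pieces \<and> (\<exists>y\<in>pts (fst i). app \<alpha> x = \<iota> X i y)" if "x \<in> pts X" for x
    using coalg_cases[OF that] by blast
  then obtain s where s: "\<And>x. x \<in> pts X \<Longrightarrow>
      s x \<in> pieces \<and> (\<exists>y\<in>pts (fst (s x)). app \<alpha> x = \<iota> X (s x) y)"
    by metis
  have "pieces \<subseteq> s ` pts X"
  proof
    fix i assume i: "i \<in> pieces"
    then obtain x y where x: "x \<in> pts X" "y \<in> pts (fst i)" "app \<alpha> x = \<iota> X i y"
      unfolding pieces_def by blast
    obtain z where z: "z \<in> pts (fst (s x))" "app \<alpha> x = \<iota> X (s x) z" using s[OF x(1)] by blast
    have "i = s x"
      using disjoint_union_eq(1)[OF union[OF X] _ _ x(2) z(1)] i s[OF x(1)] x(3) z(2)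
      unfolding pieces_def by simp
    then show "i \<in> s ` pts X" using x by blast
  qed
  then show ?thesis using assms finite_surj by blast
qed

text \<open>The mediating morphism arises by factoring \<open>\<alpha>\<close> through the summands
  that it meets, and \<open>coalg_piece\<close> shows that it restricts to \<open>f i\<close> on
  each. It is unique since \<open>counit_piece\<close> exhibits every point of \<open>X\<close> in
  the image of some \<open>snd i\<close>.\<close>

lemma coproduct_pieces: "is_coproduct rcat pieces fst X snd"
  unfolding is_coproduct_def
proof (intro conjI ballI allI impI)
  show "X \<in> Obj rcat" using X by simp
  show "fst i \<in> Obj rcat" "snd i \<in> Hom rcat (fst i) X" if "i \<in> pieces" for i
    using that K unfolding pieces_def by auto
  note snd_Hom = this(2)
  fix Y f assume Y: "Y \<in> Obj rcat" and f: "\<forall>i\<in>pieces. f i \<in> Hom rcat (fst i) Y"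
  have "\<exists>h\<in>Hom rcat X Y. \<forall>x\<in>pts X. \<forall>j\<in>pieces. \<forall>y\<in>pts (fst j).
      app \<alpha> x = \<iota> X j y \<longrightarrow> app h x = app (f j) y"
  proof (rule disjoint_union_factor[OF union[OF X] X _ coalg_Hom])
    show "\<exists>j\<in>pieces. \<exists>y\<in>pts (fst j). app \<alpha> x = \<iota> X j y" if "x \<in> pts X" for x
      using coalg_cases[OF that] by blast
    show "f j \<in> Hom rcat (fst j) Y" if "j \<in> pieces" for j
      using f that by blast
  qed (use Y in \<open>auto simp: pieces_def\<close>)
  then obtain h where h: "h \<in> Hom rcat X Y" and hf: "\<And>x j y. x \<in> pts X \<Longrightarrow> j \<in> pieces \<Longrightarrow>
      y \<in> pts (fst j) \<Longrightarrow> app \<alpha> x = \<iota> X j y \<Longrightarrow> app h x = app (f j) y"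
    by blast
  show "\<exists>!h. h \<in> Hom rcat X Y \<and> (\<forall>i\<in>pieces. h \<cdot>\<^bsub>rcat\<^esub> snd i = f i)"
  proof (intro ex1I conjI ballI)
    fix i assume i: "i \<in> pieces"
    have "fst i \<in> Obs" using i K unfolding pieces_def by auto
    then show "h \<cdot>\<^bsub>rcat\<^esub> snd i = f i"
      using f i h hf coalg_piece[OF i] app_comp[OF snd_Hom[OF i]] Hom_app[OF snd_Hom[OF i]]
      by (intro Hom_eqI[of _ "fst i" Y] comp_Hom[OF _ snd_Hom]) auto
  next
    fix h' assume h': "h' \<in> Hom rcat X Y \<and> (\<forall>i\<in>pieces. h' \<cdot>\<^bsub>rcat\<^esub> snd i = f i)"
    show "h' = h"
    proof (rule Hom_eqI)
      fix x assume x: "x \<in> pts X"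
      then obtain i y where i: "i \<in> pieces" "y \<in> pts (fst i)" "app \<alpha> x = \<iota> X i y"
        using coalg_cases by blast
      have "app h' x = app (h' \<cdot>\<^bsub>rcat\<^esub> snd i) y"
        using app_comp[OF snd_Hom[OF i(1)] i(2)] counit_piece[OF x i] by simp
      then show "app h' x = app h x" using h' i hf[OF x i] by simp
    qed (use h h' in auto)
  qed (fact h)
qed

end

end

section \<open>Size of the sums and the classification theorem\<close>

context relational_category
begin

text \<open>There are countably many carriers \<open>P n\<close>, each with at most
  \<open>C0\<close> many structures. Since every \<open>D\<close> in \<open>K\<close> is finite, an
  infinite \<open>C\<close> above \<open>C0\<close> and \<open>pts X\<close> also bounds the
  morphisms from \<open>D\<close> to \<open>X\<close>, and it absorbs the whole sum.\<close>

lemma family_sum_small: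
  assumes X: "X \<in> Obs" and K: "K \<subseteq> (\<Union>n::nat. {D \<in> Obs. pts D = P n})"
    and P: "\<And>n. finite (P n)"
  shows "\<exists>C\<in>U. (SIGMA i:(SIGMA D:K. Hom rcat D X). pts (fst i)) \<lesssim> C"
proof -
  obtain C0 where C0: "C0 \<in> U" "\<And>P. finite P \<Longrightarrow> {D \<in> Obs. pts D = P} \<lesssim> C0"
    using few_structures by blast
  obtain C where C: "C \<in> U" "infinite C" "C0 \<lesssim> C" "pts X \<lesssim> C"
    using smallness_upper_bound[OF smallness C0(1) pts_small[OF X]] .
  have fin: "finite (pts D)" if "D \<in> K" for D
    using that K P by auto
  have "(\<Union>n::nat. {D \<in> Obs. pts D = P n}) \<lesssim> C"
    using C C0(2)[OF P] lepoll_trans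
    by (intro UN_lepoll_infinite) (auto simp: infinite_le_lepoll[symmetric])
  then have "K \<lesssim> C" using K lepoll_trans subset_imp_lepoll by blast
  moreover have "Hom rcat D X \<lesssim> C" if "D \<in> K" for D
  proof -
    have "inj_on app (Hom rcat D X)" by (rule inj_onI) (metis Hom_iff)
    moreover have "app m \<in> pts D \<rightarrow>\<^sub>E pts X" if "m \<in> Hom rcat D X" for m
      using that Hom_iff[of m D X] by (simp add: hom_def)
    ultimately have "Hom rcat D X \<lesssim> (pts D \<rightarrow>\<^sub>E pts X)" unfolding lepoll_def by blast
    also have "\<dots> \<lesssim> C" using C fin[OF that] by (intro PiE_lepoll_infinite)
    finally show ?thesis .
  qed
  ultimately have "(SIGMA i:(SIGMA D:K. Hom rcat D X). pts (fst i)) \<lesssim> C"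
    using C(2) fin by (intro Sigma_lepoll_infinite) (auto intro: finite_lepoll_infinite)
  then show ?thesis using C(1) by blast
qed

theorem component_based_classified:
  assumes cb: "component_based rcat {A \<in> Obs. finite (pts A)} \<Delta>"
  shows "\<exists>\<C>. classifies rcat {A \<in> Obs. finite (pts A)} \<C> \<Delta>"
proof -
  obtain N where N: "N \<in> U" "infinite N"
    using smallness unfolding smallness_def by blast
  obtain e :: "nat \<Rightarrow> 'u" where e: "inj e" "range e \<subseteq> N"
    using infinite_countable_subset[OF N(2)] by blast
  \<comment> \<open>Carriers are limited to initial segments of the enumeration \<open>e\<close>.
    This keeps a copy of every member of \<open>\<Delta>\<close> while making \<open>K\<close> small
    enough for the sums to exist.\<close>
  define K where "K = {D \<in> \<Delta>. \<exists>n. pts D = e ` {..<n}}"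
  have \<Delta>: "\<Delta> \<subseteq> {A \<in> Obs. finite (pts A)}"
    and iso: "\<forall>X\<in>\<Delta>. \<forall>Y\<in>Obj rcat. isomorphic rcat X Y \<longrightarrow> Y \<in> \<Delta>"
    and cop: "\<forall>(n::nat) A S \<iota>. (\<forall>i<n. A i \<in> \<Delta>) \<and> is_coproduct rcat {..<n} A S \<iota> \<longrightarrow> S \<in> \<Delta>"
    using cb unfolding component_based_def by - (elim conjE, assumption)+
  have K: "K \<subseteq> Obs" and K\<Delta>: "K \<subseteq> \<Delta>" using \<Delta> by (auto simp: K_def)
  have "\<exists>S \<iota>. disjoint_union (SIGMA D:K. Hom rcat D X) fst S \<iota>" if X: "X \<in> Obs" for X
  proof -
    have "K \<subseteq> (\<Union>n. {D \<in> Obs. pts D = e ` {..<n}})" using K by (auto simp: K_def)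
    then have "\<exists>C\<in>U. (SIGMA i:(SIGMA D:K. Hom rcat D X). pts (fst i)) \<lesssim> C"
      by (intro family_sum_small[OF X]) auto
    then obtain C where "C \<in> U" "(SIGMA i:(SIGMA D:K. Hom rcat D X). pts (fst i)) \<lesssim> C" ..
    then show ?thesis using K by (intro disjoint_union_exists[of _ fst C]) auto
  qed
  then obtain T \<iota> where "\<And>X. X \<in> Obs \<Longrightarrow> disjoint_union (SIGMA D:K. Hom rcat D X) fst (T X) (\<iota> X)"
    by metis
  then interpret relational_family U Obs pts \<sigma> rel K T \<iota>
    using K by unfold_locales
  have "X \<in> \<Delta> \<longleftrightarrow> (\<exists>\<alpha>. coalgebra rcat C.T_comonad X \<alpha>)" if X: "X \<in> Obs" "finite (pts X)" for X
  proof
    assume "X \<in> \<Delta>"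
    have "e ` {..<card (pts X)} \<approx> pts X"
      using X(2) by (simp add: eqpoll_iff_card card_image inj_on_subset[OF e(1)])
    then obtain b where b: "bij_betw b (pts X) (e ` {..<card (pts X)})"
      using eqpoll_sym unfolding eqpoll_def by blast
    \<comment> \<open>The copy of \<open>X\<close> on the initial segment of length
      \<open>card (pts X)\<close> stays in \<open>\<Delta>\<close> by closure under isomorphism, and
      so belongs to \<open>K\<close>.\<close>
    obtain D where D: "D \<in> Obs" "pts D = b ` pts X" "isomorphic rcat X D"
      using transport[OF X(1) bij_betw_imp_inj_on[OF b]] smallness_finite[OF smallness] X(2) by blast
    have "D \<in> K"
      using iso \<open>X \<in> \<Delta>\<close> D b by (auto simp: K_def bij_betw_def)
    then show "\<exists>\<alpha>. coalgebra rcat C.T_comonad X \<alpha>"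
      using C.coalgebra_if_isomorphic isomorphic_sym[OF D(3)] X(1) by simp
  next
    assume "\<exists>\<alpha>. coalgebra rcat C.T_comonad X \<alpha>"
    then obtain \<alpha> where \<alpha>: "coalgebra rcat C.T_comonad X \<alpha>" ..
    \<comment> \<open>Numbering the pieces allows closure under finite coproducts to be applied. For
      empty \<open>X\<close> there are no pieces, and the empty coproduct is used.\<close>
    obtain b where b: "bij_betw b {..<card (pieces X \<alpha>)} (pieces X \<alpha>)"
      using ex_bij_betw_nat_finite[OF finite_pieces[OF X(1) \<alpha> X(2)]] by (auto simp: atLeast0LessThan)
    have "is_coproduct rcat {..<card (pieces X \<alpha>)} (fst \<circ> b) X (snd \<circ> b)"
      using coproduct_reindex[OF b coproduct_pieces[OF X(1) \<alpha>]] .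
    moreover have "fst i \<in> \<Delta>" if "i \<in> pieces X \<alpha>" for i
      using that K\<Delta> unfolding pieces_def[OF X(1) \<alpha>] by auto
    then have "\<forall>i<card (pieces X \<alpha>). (fst \<circ> b) i \<in> \<Delta>"
      using bij_betwE[OF b] by simp
    ultimately show "X \<in> \<Delta>"
      using cop[rule_format, of "card (pieces X \<alpha>)" "fst \<circ> b" X "snd \<circ> b"] by blast
  qed
  then have "classifies rcat {A \<in> Obs. finite (pts A)} C.T_comonad \<Delta>"
    using C.comonad_T by (simp add: classifies_def)
  then show ?thesis ..
qed

end

section \<open>Structures and graphs\<close>

lemma finite_tuples: "finite P \<Longrightarrow> finite {xs. length xs = n \<and> set xs \<subseteq> P}"
  using finite_lists_length_eq[of P n] by (simp add: conj_commute)

text \<open>A structure on \<open>P\<close> is determined by its set of pairs of a symbol and a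
  tuple. Over finite \<open>P\<close> each symbol has finitely many tuples, so there are finitely
  many such pairs if \<open>\<sigma>\<close> is finite, and otherwise at most as many as symbols. In
  the latter case the bound on \<open>Pow \<sigma>\<close> in \<open>signature\<close>
  applies.\<close>

lemma few_structs:
  assumes "smallness U" "signature U \<sigma> ar"
  shows "\<exists>C\<in>U. \<forall>P. finite P \<longrightarrow> {D \<in> Obj (Struct_cat U \<sigma> ar). points D = P} \<lesssim> C"
proof -
  obtain B where B: "B \<in> U" "Pow \<sigma> \<lesssim> B" using assms(2) unfolding signature_def by blast
  obtain C where C: "C \<in> U" "infinite C" "B \<lesssim> C"
    using smallness_upper_bound[OF assms(1) B(1) B(1)] .
  have "{D \<in> Obj (Struct_cat U \<sigma> ar). points D = P} \<lesssim> C" if P: "finite P" for P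
  proof -
    let ?t = "SIGMA R:\<sigma>. {xs. length xs = ar R \<and> set xs \<subseteq> P}"
    let ?S = "{D \<in> Obj (Struct_cat U \<sigma> ar). points D = P}"
    let ?f = "\<lambda>D. Sigma UNIV (interp D)"
    have "inj_on ?f ?S"
    proof (rule inj_onI)
      fix D E assume DE: "D \<in> ?S" "E \<in> ?S" and eq: "?f D = ?f E"
      have "interp D R = interp E R" for R using eq by (auto simp: set_eq_iff)
      then show "D = E" using DE by (cases D, cases E) auto
    qed
    moreover have "?f ` ?S \<subseteq> Pow ?t"
    proof safe
      fix D R xs assume D: "D \<in> Obj (Struct_cat U \<sigma> ar)" and xs: "xs \<in> interp D R" and "P = points D"
      then have *: "is_struct \<sigma> ar D" by (simp add: Struct_cat_def)
      \<comment> \<open>Symbols outside the signature have empty interpretation, so holding a tuple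
        forces \<open>R\<close> into \<open>\<sigma>\<close>.\<close>
      then have R: "R \<in> \<sigma>" using xs by (auto simp: is_struct_def)
      with * xs show "R \<in> \<sigma>" "length xs = ar R" "\<And>x. x \<in> set xs \<Longrightarrow> x \<in> points D"
        by (auto simp: is_struct_def)
    qed
    ultimately have "?S \<lesssim> Pow ?t" unfolding lepoll_def by blast
    also have "Pow ?t \<lesssim> C"
    proof (cases "finite \<sigma>")
      case True
      then have "finite (Pow ?t)" using P by (simp add: finite_tuples)
      then show ?thesis using C(2) finite_lepoll_infinite by blast
    next
      case False
      then have "?t \<lesssim> \<sigma>"
        using P by (intro Sigma_lepoll_infinite) (auto intro: finite_lepoll_infinite finite_tuples)
      then have "Pow ?t \<lesssim> Pow \<sigma>" by (rule Pow_lepoll_mono)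
      from lepoll_trans[OF lepoll_trans[OF this B(2)] C(3)] show ?thesis .
    qed
    finally show ?thesis .
  qed
  then show ?thesis using C(1) by blast
qed

lemma relational_category_struct:
  fixes U :: "'u set set" and \<sigma> :: "'r set"
  assumes "smallness U" "signature U \<sigma> ar"
  shows "relational_category U (Obj (Struct_cat U \<sigma> ar)) points \<sigma> interp"
proof
  show "smallness U" by fact
  show "\<exists>C\<in>U. \<forall>P. finite P \<longrightarrow> {D \<in> Obj (Struct_cat U \<sigma> ar). points D = P} \<lesssim> C"
    using few_structs[OF assms] .
  show "points A \<in> U" if "A \<in> Obj (Struct_cat U \<sigma> ar)" for A
    using that by (simp add: Struct_cat_def)
  \<comment> \<open>Non-emptiness of tuples is positivity of the arities.\<close>
  show "xs \<noteq> [] \<and> set xs \<subseteq> points A"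
    if "A \<in> Obj (Struct_cat U \<sigma> ar)" "R \<in> \<sigma>" "xs \<in> interp A R" for A R xs
    using that assms(2) by (fastforce simp: Struct_cat_def is_struct_def signature_def)
next
  fix I :: "(('r, 'u) struct \<times> ('r, 'u) struct \<times> ('u \<Rightarrow> 'u) \<times> ('r, 'u) struct) set"
    and A :: "_ \<Rightarrow> ('r, 'u) struct" and \<iota> :: "_ \<Rightarrow> 'u \<Rightarrow> 'u"
  assume A: "\<And>i. i \<in> I \<Longrightarrow> A i \<in> Obj (Struct_cat U \<sigma> ar)"
    and P: "(\<Union>i\<in>I. \<iota> i ` points (A i)) \<in> U"
  let ?S = "\<lparr>points = \<Union>i\<in>I. \<iota> i ` points (A i),
    interp = \<lambda>R. if R \<in> \<sigma> then \<Union>i\<in>I. map (\<iota> i) ` interp (A i) R else {}\<rparr>"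
  have "is_struct \<sigma> ar ?S"
    using A by (fastforce simp: Struct_cat_def is_struct_def)
  then show "\<exists>S\<in>Obj (Struct_cat U \<sigma> ar). points S = (\<Union>i\<in>I. \<iota> i ` points (A i)) \<and>
      (\<forall>R\<in>\<sigma>. interp S R = (\<Union>i\<in>I. map (\<iota> i) ` interp (A i) R))"
    using P by (intro bexI[of _ ?S]) (auto simp: Struct_cat_def)
qed

lemma struct_classified:
  assumes "smallness U" "signature U \<sigma> ar"
    "component_based (Struct_cat U \<sigma> ar) (finite_structs U \<sigma> ar) \<Delta>"
  shows "\<exists>\<C>. classifies (Struct_cat U \<sigma> ar) (finite_structs U \<sigma> ar) \<C> \<Delta>"
proof -
  interpret relational_category U "Obj (Struct_cat U \<sigma> ar)" points \<sigma> interp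
    using relational_category_struct[OF assms(1,2)] .
  have "Struct_cat U \<sigma> ar = rcat"
    unfolding rcat_def hom_def by (simp add: Struct_cat_def struct_hom_def)
  then show ?thesis
    using component_based_classified[of \<Delta>] assms(3) by (simp add: finite_structs_def)
qed

section \<open>Graphs as structures with a single binary symbol\<close>

definition edges :: "'u ugraph \<Rightarrow> unit \<Rightarrow> 'u list set" where
  "edges G R = {[x, y] | x y. (x, y) \<in> adj G}"

text \<open>A finite vertex set carries only finitely many graphs, so any infinite member of
  \<open>U\<close> bounds their number. For disjoint unions the point to check is the absence of
  loops.\<close>

lemma relational_category_graph:
  fixes U :: "'u set set"
  assumes "smallness U"
  shows "relational_category U (Obj (Graph_cat U)) verts UNIV edges"
proof
  show "smallness U" by fact
  obtain C where C: "C \<in> U" "infinite C" using assms unfolding smallness_def by blast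
  have "{D \<in> Obj (Graph_cat U). verts D = P} \<lesssim> C" if P: "finite P" for P
  proof -
    have "{D \<in> Obj (Graph_cat U). verts D = P} \<subseteq> (\<lambda>E. \<lparr>verts = P, adj = E\<rparr>) ` Pow (P \<times> P)"
    proof
      fix D assume D: "D \<in> {D \<in> Obj (Graph_cat U). verts D = P}"
      then show "D \<in> (\<lambda>E. \<lparr>verts = P, adj = E\<rparr>) ` Pow (P \<times> P)"
        by (intro image_eqI[of _ _ "adj D"]) (auto simp: Graph_cat_def is_ugraph_def)
    qed
    then have "finite {D \<in> Obj (Graph_cat U). verts D = P}"
      using P by (meson finite_Pow_iff finite_SigmaI finite_imageI finite_subset)
    then show ?thesis using C(2) finite_lepoll_infinite by blast
  qed
  then show "\<exists>C\<in>U. \<forall>P. finite P \<longrightarrow> {D \<in> Obj (Graph_cat U). verts D = P} \<lesssim> C"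
    using C(1) by blast
  show "verts A \<in> U" if "A \<in> Obj (Graph_cat U)" for A
    using that by (simp add: Graph_cat_def)
  show "xs \<noteq> [] \<and> set xs \<subseteq> verts A"
    if "A \<in> Obj (Graph_cat U)" "R \<in> UNIV" "xs \<in> edges A R" for A R xs
    using that by (auto simp: Graph_cat_def is_ugraph_def edges_def)
next
  fix I :: "('u ugraph \<times> 'u ugraph \<times> ('u \<Rightarrow> 'u) \<times> 'u ugraph) set"
    and A :: "_ \<Rightarrow> 'u ugraph" and \<iota> :: "_ \<Rightarrow> 'u \<Rightarrow> 'u"
  assume A: "\<And>i. i \<in> I \<Longrightarrow> A i \<in> Obj (Graph_cat U)"
    and inj: "inj_on (\<lambda>(i, y). \<iota> i y) (SIGMA i:I. verts (A i))"
    and P: "(\<Union>i\<in>I. \<iota> i ` verts (A i)) \<in> U"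
  let ?S = "\<lparr>verts = \<Union>i\<in>I. \<iota> i ` verts (A i), adj = \<Union>i\<in>I. map_prod (\<iota> i) (\<iota> i) ` adj (A i)\<rparr>"
  have adj: "x \<in> verts (A i)" "y \<in> verts (A i)" "(y, x) \<in> adj (A i)" "x \<noteq> y"
    if "i \<in> I" "(x, y) \<in> adj (A i)" for i x y
    using A[OF that(1)] that(2) unfolding Graph_cat_def is_ugraph_def irrefl_def sym_def by auto
  \<comment> \<open>A loop in the union would need two adjacent vertices of one summand to be
    identified, which injectivity of \<open>\<iota> i\<close> excludes.\<close>
  have "\<iota> i x \<noteq> \<iota> i y" if "i \<in> I" "(x, y) \<in> adj (A i)" for i x y
    using inj_onD[OF inj, of "(i, x)" "(i, y)"] adj[OF that] that(1) by auto
  then have "is_ugraph ?S"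
    using adj unfolding is_ugraph_def irrefl_def sym_def by fastforce
  moreover have "edges ?S R = (\<Union>i\<in>I. map (\<iota> i) ` edges (A i) R)" for R
    unfolding edges_def by force
  ultimately show "\<exists>S\<in>Obj (Graph_cat U). verts S = (\<Union>i\<in>I. \<iota> i ` verts (A i)) \<and>
      (\<forall>R\<in>UNIV. edges S R = (\<Union>i\<in>I. map (\<iota> i) ` edges (A i) R))"
    using P by (intro bexI[of _ ?S]) (auto simp: Graph_cat_def)
qed

lemma graph_classified:
  assumes "smallness U" "component_based (Graph_cat U) (finite_ugraphs U) \<Delta>"
  shows "\<exists>\<C>. classifies (Graph_cat U) (finite_ugraphs U) \<C> \<Delta>"
proof -
  interpret relational_category U "Obj (Graph_cat U)" verts UNIV edges
    using relational_category_graph[OF assms(1)] .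
  have "ugraph_hom G H = hom G H" for G H
    unfolding ugraph_hom_def hom_def edges_def by auto
  then have "Graph_cat U = rcat"
    unfolding rcat_def by (simp add: Graph_cat_def)
  then show ?thesis
    using component_based_classified[of \<Delta>] assms(2) by (simp add: finite_ugraphs_def)
qed

theorem theorem1p1:
  fixes U :: "'u set set"
  assumes "smallness U"
  shows "(\<forall>(\<sigma> :: 'r set) ar \<Delta>.
            signature U \<sigma> ar \<longrightarrow>
            component_based (Struct_cat U \<sigma> ar) (finite_structs U \<sigma> ar) \<Delta> \<longrightarrow>
            (\<exists>\<C>. classifies (Struct_cat U \<sigma> ar) (finite_structs U \<sigma> ar) \<C> \<Delta>)) \<and>
         (\<forall>\<Delta>. component_based (Graph_cat U) (finite_ugraphs U) \<Delta> \<longrightarrow>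
            (\<exists>\<C>. classifies (Graph_cat U) (finite_ugraphs U) \<C> \<Delta>))"
  using struct_classified[OF assms] graph_classified[OF assms] by blast

end
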